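(* There exist absolute constants $c_1,c_2\in\mathbb N$ such that for every $d\in\mathbb N$, every positive function $\omega$ on $\mathbb Z^d$ with $\sum_{\mathbf k\in\mathbb Z^d}\omega(\mathbf k)^{-2}<\infty$, and every $m\in\mathbb N$, $$ g_{c_1m}({\rm APP}_{\infty,d})\le c_2\,a_{m+1}({\rm APP}_{\infty,d})=c_2\Big(\sum_{k=m+1}^\infty\lambda_{k,d}\Big)^{1/2};$$ in other words $e(c_1m,{\rm APP}_{\infty,d};\Lambda^{\rm std})\le c_2\, e(m,{\rm APP}_{\infty,d};\Lambda^{\rm all})$.
   Context: $\mathbb T^d=[0,1]^d$ is the $d$-dimensional torus with Lebesgue measure. For $f\in L_1(\mathbb T^d)$, $\hat f(\mathbf k)=\int_{\mathbb T^d}f(\mathbf x)e^{-2\pi i\mathbf k\cdot\mathbf x}d\mathbf x$. $H^\omega(\mathbb T^d)$ is the Hilbert space of $f\in L_2(\mathbb T^d)$ with $\|f\|_{H^\omega}^2=\sum_{\mathbf k\in\mathbb Z^d}|\hat f(\mathbf k)|^2\omega(\mathbf k)^2<\infty$; under the summability assumption it is a reproducing kernel Hilbert space of continuous functions embedded in $L_\infty(\mathbb T^d)$ (sup norm). ${\rm APP}_{\infty,d}:H^\omega(\mathbb T^d)\to L_\infty(\mathbb T^d)$, $f\mapsto f$. $\{\lambda_{k,d}\}_{k\in\mathbb N}$ is the nonincreasing rearrangement of $\{\omega(\mathbf k)^{-2}\}_{\mathbf k\in\mathbb Z^d}$. $\Lambda^{\rm all}$ is the class of all continuous linear functionals on $H^\omega(\mathbb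 T^d)$ and $\Lambda^{\rm std}$ the class of point evaluations $f\mapsto f(\mathbf x)$. For $\Lambda\in\{\Lambda^{\rm all},\Lambda^{\rm std}\}$, $e(n,{\rm APP}_{\infty,d};\Lambda)$ is the infimum, over algorithms $A(f)=\phi(L_1f,\dots,L_nf)$ with $L_i\in\Lambda$ and arbitrary $\phi:\mathbb C^n\to L_\infty(\mathbb T^d)$, of $\sup_{\|f\|_{H^\omega}\le1}\|f-A(f)\|_\infty$. The sampling number is $g_n({\rm APP}_{\infty,d})=e(n,{\rm APP}_{\infty,d};\Lambda^{\rm std})$ and the approximation number is $a_{n+1}({\rm APP}_{\infty,d})=e(n,{\rm APP}_{\infty,d};\Lambda^{\rm all})$ (the infimum of worst-case errors of linear operators of rank at most $n$). *)

theory Defs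
  imports "HOL-Analysis.Analysis" "HOL-Probability.Essential_Supremum"
begin

text \<open>Frequencies: \<open>\<int>^d\<close> rendered as integer vectors indexed by nat, zero outside \<open>{..<d}\<close>.\<close>
definition freqs :: "nat \<Rightarrow> (nat \<Rightarrow> int) set" where
  "freqs d = {k. \<forall>i\<ge>d. k i = 0}"

definition torus :: "nat \<Rightarrow> (nat \<Rightarrow> real) measure" where
  "torus d = PiM {..<d} (\<lambda>_. restrict_space lborel {0..1::real})"

definition dotk :: "nat \<Rightarrow> (nat \<Rightarrow> int) \<Rightarrow> (nat \<Rightarrow> real) \<Rightarrow> real" where
  "dotk d k x = (\<Sum>i<d. of_int (k i) * x i)"

definition fhat :: "nat \<Rightarrow> ((nat \<Rightarrow> real) \<Rightarrow> complex) \<Rightarrow> (nat \<Rightarrow> int) \<Rightarrow> complex" where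
  "fhat d f k = integral\<^sup>L (torus d)
     (\<lambda>x. f x * exp (- 2 * complex_of_real pi * \<i> * complex_of_real (dotk d k x)))"

text \<open>\<open>H^\<omega>(\<T>^d)\<close>: functions with weighted square-summable Fourier coefficients,
  taken as their continuous representative (the pointwise Fourier series).\<close>
definition Hspace :: "nat \<Rightarrow> ((nat \<Rightarrow> int) \<Rightarrow> real) \<Rightarrow> ((nat \<Rightarrow> real) \<Rightarrow> complex) set" where
  "Hspace d \<omega> = {f. (\<lambda>k. (cmod (fhat d f k))\<^sup>2 * (\<omega> k)\<^sup>2) summable_on freqs d \<and>
      (\<forall>x. f x = (\<Sum>\<^sub>\<infinity>k\<in>freqs d. fhat d f k *
                     exp (2 * complex_of_real pi * \<i> * complex_of_real (dotk d k x))))}"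

definition Hnorm :: "nat \<Rightarrow> ((nat \<Rightarrow> int) \<Rightarrow> real) \<Rightarrow> ((nat \<Rightarrow> real) \<Rightarrow> complex) \<Rightarrow> real" where
  "Hnorm d \<omega> f = sqrt (\<Sum>\<^sub>\<infinity>k\<in>freqs d. (cmod (fhat d f k))\<^sup>2 * (\<omega> k)\<^sup>2)"

definition Lall :: "nat \<Rightarrow> ((nat \<Rightarrow> int) \<Rightarrow> real) \<Rightarrow> (((nat \<Rightarrow> real) \<Rightarrow> complex) \<Rightarrow> complex) set" where
  "Lall d \<omega> = {L. (\<forall>f\<in>Hspace d \<omega>. \<forall>g\<in>Hspace d \<omega>. L (\<lambda>x. f x + g x) = L f + L g) \<and>
                 (\<forall>f\<in>Hspace d \<omega>. \<forall>a. L (\<lambda>x. a * f x) = a * L f) \<and>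
                 (\<exists>C. \<forall>f\<in>Hspace d \<omega>. cmod (L f) \<le> C * Hnorm d \<omega> f)}"

definition Lstd :: "nat \<Rightarrow> (((nat \<Rightarrow> real) \<Rightarrow> complex) \<Rightarrow> complex) set" where
  "Lstd d = {L. \<exists>x\<in>space (torus d). L = (\<lambda>f. f x)}"

definition err :: "nat \<Rightarrow> ((nat \<Rightarrow> int) \<Rightarrow> real) \<Rightarrow> (((nat \<Rightarrow> real) \<Rightarrow> complex) \<Rightarrow> complex) set
                   \<Rightarrow> nat \<Rightarrow> ereal" where
  "err d \<omega> \<Lambda> n =
     (INF LP \<in> {(L, \<phi>). \<forall>i<n. L i \<in> \<Lambda>}.
        SUP f \<in> {f \<in> Hspace d \<omega>. Hnorm d \<omega> f \<le> 1}.
          esssup (torus d) (\<lambda>x. ereal (cmod (f x -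
             (snd LP) (\<lambda>i. if i < n then (fst LP) i f else 0) x))))"

definition sampling_num :: "nat \<Rightarrow> ((nat \<Rightarrow> int) \<Rightarrow> real) \<Rightarrow> nat \<Rightarrow> ereal" where
  "sampling_num d \<omega> n = err d \<omega> (Lstd d) n"

text \<open>\<open>a_n = e(n-1, APP; \<Lambda>^all)\<close> for \<open>n \<ge> 1\<close>.\<close>
definition approx_num :: "nat \<Rightarrow> ((nat \<Rightarrow> int) \<Rightarrow> real) \<Rightarrow> nat \<Rightarrow> ereal" where
  "approx_num d \<omega> n = err d \<omega> (Lall d \<omega>) (n - 1)"

text \<open>\<open>\<lambda>_{k,d}\<close> (\<open>k \<ge> 1\<close>): the k-th largest value (with multiplicity) of \<open>\<omega>(k)^{-2}\<close>.\<close>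
definition lam :: "nat \<Rightarrow> ((nat \<Rightarrow> int) \<Rightarrow> real) \<Rightarrow> nat \<Rightarrow> real" where
  "lam d \<omega> k = Sup {t. t > 0 \<and> k \<le> card {j \<in> freqs d. t \<le> 1 / (\<omega> j)\<^sup>2}}"

end

theory Submission
  imports Defs "HOL-Probability.Infinite_Product_Measure"
begin

text \<open>
The worst-case sampling error at points \<open>x\<^sub>1, \<dots>, x\<^sub>n\<close> is governed by the residual of the
reproducing kernel \<open>K\<close> after eliminating these points (an iterated Schur complement), and
each new point multiplies the Gram determinant by its residual. Let \<open>T\<close> be the sum of
\<open>\<lambda>\<^sub>k\<close> over \<open>k > m\<close> and let \<open>q \<le> m\<close> be the number of leading weights that are at least
\<open>T / m\<close>. Averaging a determinant over the torus yields \<open>q\<close> points with Gram determinant at least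
\<open>q! \<lambda>\<^sub>1 \<cdots> \<lambda>\<^sub>q\<close>. If the residual exceeded \<open>36 T\<close> somewhere for every set of at most \<open>2m\<close> points,
a greedy extension to \<open>2m\<close> points would have Gram determinant at least
\<open>q! \<lambda>\<^sub>1 \<cdots> \<lambda>\<^sub>q (36 T)\<^bsup>2m-q\<^esup>\<close>. On the other hand, lowering the first \<open>q\<close> weights to \<open>T / m\<close> changes
the determinant at most by the factor \<open>\<lambda>\<^sub>1 \<cdots> \<lambda>\<^sub>q (m / T)\<^sup>q\<close> and leaves a kernel with diagonal at
most \<open>3 T\<close>, so Hadamard's inequality bounds it by \<open>\<lambda>\<^sub>1 \<cdots> \<lambda>\<^sub>q (m / T)\<^sup>q (3 T)\<^bsup>2m\<^esup>\<close>. As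
\<open>m\<^sup>q \<le> 3\<^sup>m q!\<close>, this is a contradiction.

The lower bound for arbitrary linear information averages, over the torus, the squared norm of the
representer of point evaluation projected onto the common kernel of the functionals.
\<close>

section \<open>Positive semidefinite kernels, Schur complements and Gram determinants\<close>

type_synonym 'a kernel = "'a \<Rightarrow> 'a \<Rightarrow> complex"

definition qform :: "'a kernel \<Rightarrow> (nat \<Rightarrow> 'a) \<Rightarrow> (nat \<Rightarrow> complex) \<Rightarrow> nat \<Rightarrow> complex" where
  "qform k z c n = (\<Sum>i<n. \<Sum>j<n. c i * cnj (c j) * k (z i) (z j))"

definition hermitian :: "'a kernel \<Rightarrow> bool" where
  "hermitian k \<longleftrightarrow> (\<forall>x y. k y x = cnj (k x y))"

definition kernel_le :: "'a kernel \<Rightarrow> 'a kernel \<Rightarrow> bool" where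
  "kernel_le k k' \<longleftrightarrow> (\<forall>z c n. Re (qform k z c n) \<le> Re (qform k' z c n))"

definition psd :: "'a kernel \<Rightarrow> bool" where
  "psd k \<longleftrightarrow> hermitian k \<and> (\<forall>z c n. 0 \<le> Re (qform k z c n))"

definition rank_one :: "('a \<Rightarrow> complex) \<Rightarrow> 'a kernel" where
  "rank_one v x y = v x * cnj (v y)"

text \<open>If \<open>k a a = 0\<close>, division by zero leaves \<open>k\<close> unchanged. For a
  psd kernel this is the correct convention, since the row and column of \<open>a\<close> then
  vanish.\<close>

definition schur :: "'a kernel \<Rightarrow> 'a \<Rightarrow> 'a kernel" where
  "schur k a x y = k x y - k x a * k a y / k a a"

fun residual :: "'a kernel \<Rightarrow> 'a list \<Rightarrow> 'a kernel" where
  "residual k [] = k"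
| "residual k (x # xs) = residual (schur k x) xs"

text \<open>The Gram determinant of the list, encoded as the product of the pivots of successive
  eliminations, so that inductions over the points need no matrices.\<close>

fun gram_vol :: "'a kernel \<Rightarrow> 'a list \<Rightarrow> real" where
  "gram_vol k [] = 1"
| "gram_vol k (x # xs) = Re (k x x) * gram_vol (schur k x) xs"

section \<open>Quadratic forms of kernels and elimination of a point\<close>

lemma rank_one_diag: "Re (rank_one h x x) = (cmod (h x))\<^sup>2"
  unfolding rank_one_def complex_norm_square[symmetric] Re_complex_of_real ..

lemma hermitianD: "hermitian k \<Longrightarrow> k y x = cnj (k x y)"
  unfolding hermitian_def by blast

lemma hermitian_diag: "hermitian k \<Longrightarrow> k x x = of_real (Re (k x x))"
  by (metis Reals_cnj_iff hermitianD of_real_Re)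

lemma psd_hermitian: "psd k \<Longrightarrow> hermitian k"
  by (simp add: psd_def)

lemma qform_cong:
  assumes "\<And>i. i < n \<Longrightarrow> c i = c' i" "\<And>i. i < n \<Longrightarrow> z i = z' i"
  shows "qform k z c n = qform k z' c' n"
  unfolding qform_def using assms by (intro sum.cong refl) auto

lemma qform_one: "qform k (\<lambda>_. x) (\<lambda>_. 1) 1 = k x x"
  by (simp add: qform_def)

lemma psd_diag: "psd k \<Longrightarrow> 0 \<le> Re (k x x)"
  by (metis psd_def qform_one)

lemma kernel_le_diag: "kernel_le k k' \<Longrightarrow> Re (k x x) \<le> Re (k' x x)"
  by (metis kernel_le_def qform_one)

lemma qform_Suc:
  assumes "hermitian k"
  shows "Re (qform k z c (Suc n)) = Re (qform k z c n)
     + 2 * Re (cnj (c n) * (\<Sum>i<n. c i * k (z i) (z n))) + (cmod (c n))\<^sup>2 * Re (k (z n) (z n))"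
proof -
  let ?s = "\<Sum>i<n. c i * k (z i) (z n)"
  have 1: "(\<Sum>i<n. c i * cnj (c n) * k (z i) (z n)) = cnj (c n) * ?s"
    by (simp add: sum_distrib_left mult_ac)
  have 2: "(\<Sum>j<n. c n * cnj (c j) * k (z n) (z j)) = cnj (cnj (c n) * ?s)"
    by (simp add: sum_distrib_left mult_ac hermitianD[OF assms, where y = "z n"])
  have 3: "c n * cnj (c n) * k (z n) (z n) = of_real ((cmod (c n))\<^sup>2) * k (z n) (z n)"
    by (simp add: complex_norm_square del: of_real_power)
  have "qform k z c (Suc n) = qform k z c n + ((\<Sum>i<n. c i * cnj (c n) * k (z i) (z n))
      + (\<Sum>j<n. c n * cnj (c j) * k (z n) (z j))) + c n * cnj (c n) * k (z n) (z n)"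
    by (simp add: qform_def sum.distrib)
  then have "qform k z c (Suc n) = qform k z c n + (cnj (c n) * ?s + cnj (cnj (c n) * ?s))
      + of_real ((cmod (c n))\<^sup>2) * k (z n) (z n)"
    unfolding 1 2 3 .
  moreover have "Re (u + (w + cnj w) + of_real r * y) = Re u + 2 * Re w + r * Re y" for u w y r
    by simp
  ultimately show ?thesis by (simp only:)
qed

text \<open>Appending the point \<open>a\<close> with coefficient \<open>t\<close> gives a quadratic
  polynomial in \<open>t\<close>; its minimisation is what produces the Schur complement.\<close>

lemma qform_extend:
  assumes "hermitian k"
  shows "Re (qform k (z(n := a)) (c(n := t)) (Suc n)) = Re (qform k z c n)
     + 2 * Re (cnj t * (\<Sum>i<n. c i * k (z i) a)) + (cmod t)\<^sup>2 * Re (k a a)"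
proof -
  have "qform k (z(n := a)) (c(n := t)) n = qform k z c n"
    by (rule qform_cong) auto
  moreover have "(\<Sum>i<n. (c(n := t)) i * k ((z(n := a)) i) ((z(n := a)) n)) = (\<Sum>i<n. c i * k (z i) a)"
    by (intro sum.cong) auto
  ultimately show ?thesis
    by (subst qform_Suc[OF assms]) simp
qed

lemma hermitian_schur: "hermitian k \<Longrightarrow> hermitian (schur k a)"
  unfolding hermitian_def schur_def by (metis complex_cnj_diff complex_cnj_divide complex_cnj_mult mult.commute)

lemma qform_schur:
  assumes "hermitian k"
  shows "Re (qform (schur k a) z c n) =
    Re (qform k z c n) - (cmod (\<Sum>i<n. c i * k (z i) a))\<^sup>2 / Re (k a a)"
proof -
  let ?s = "\<Sum>i<n. c i * k (z i) a"
  have 1: "cnj ?s = (\<Sum>j<n. cnj (c j) * k a (z j))"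
    by (simp add: hermitianD[OF assms, where y = a])
  have "qform (schur k a) z c n = qform k z c n - ?s * cnj ?s / k a a"
    unfolding 1 unfolding qform_def schur_def sum_product
    by (simp add: sum_subtractf algebra_simps sum_divide_distrib)
  also have "?s * cnj ?s / k a a = of_real ((cmod ?s)\<^sup>2 / Re (k a a))"
    by (subst hermitian_diag[OF assms, of a]) (simp add: complex_norm_square del: of_real_power)
  finally show ?thesis by (simp only: minus_complex.sel Re_complex_of_real)
qed

text \<open>With zero pivot the extended form is affine in the coefficient at \<open>a\<close>, so a
  nonzero linear part would make it negative somewhere.\<close>

lemma psd_isotropic:
  assumes "psd k" "Re (k a a) = 0"
  shows "(\<Sum>i<(n::nat). c i * k (z i) a) = 0"
proof (rule ccontr)
  define s where "s = (\<Sum>i<n. c i * k (z i) a)"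
  assume "(\<Sum>i<n. c i * k (z i) a) \<noteq> 0"
  then have "s \<noteq> 0" by (simp add: s_def)
  \<comment> \<open>With \<open>Q\<close> the original form, this factor brings the extended form
    down to \<open>- Q - 2\<close>, which is negative because \<open>Q \<ge> 0\<close>.\<close>
  define r where "r = (Re (qform k z c n) + 1) / (cmod s)\<^sup>2"
  have "0 \<le> Re (qform k (z(n := a)) (c(n := - of_real r * s)) (Suc n))"
    using assms(1) by (simp add: psd_def)
  also have "\<dots> = Re (qform k z c n) - 2 * (r * (cmod s)\<^sup>2)"
    unfolding qform_extend[OF psd_hermitian[OF assms(1)]] s_def[symmetric] assms(2) cmod_power2
    by (simp add: power2_eq_square algebra_simps)
  also have "r * (cmod s)\<^sup>2 = Re (qform k z c n) + 1"
    using \<open>s \<noteq> 0\<close> by (simp add: r_def)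
  finally have "Re (qform k z c n) + 2 \<le> 0" by simp
  moreover have "0 \<le> Re (qform k z c n)" using assms(1) by (simp add: psd_def)
  ultimately show False by linarith
qed

lemma psd_isotropic_row:
  assumes "psd k" "Re (k a a) = 0"
  shows "k x a = 0" "k a x = 0"
proof -
  show "k x a = 0" using psd_isotropic[OF assms, of "\<lambda>_. 1" "\<lambda>_. x" "Suc 0"] by simp
  then show "k a x = 0" using hermitianD[OF psd_hermitian[OF assms(1)], where y = a and x = x] by simp
qed

text \<open>The quadratic form of a Schur complement is the minimum of the original form over the
  coefficient at the eliminated point.\<close>

lemma qform_schur_le:
  assumes "psd k"
  shows "Re (qform (schur k a) z c n) \<le> Re (qform k (z(n := a)) (c(n := t)) (Suc n))"
proof -
  define s where "s = (\<Sum>i<n. c i * k (z i) a)"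
  let ?A = "Re (k a a)"
  note h = psd_hermitian[OF assms]
  show ?thesis
  proof (cases "?A = 0")
    case True
    then show ?thesis
      unfolding qform_schur[OF h] qform_extend[OF h] s_def[symmetric] using psd_isotropic[OF assms True, of c z n, folded s_def] by simp
  next
    case False
    then have A: "?A > 0" using psd_diag[OF assms, of a] by simp
    \<comment> \<open>Completing the square in \<open>t\<close>: the difference of the two forms is
      this square divided by the pivot.\<close>
    have "(cmod (s + t * of_real ?A))\<^sup>2 = (cmod s)\<^sup>2 + 2 * Re (cnj t * s) * ?A + (cmod t)\<^sup>2 * ?A\<^sup>2"
      by (simp add: cmod_power2) (simp add: power2_eq_square algebra_simps)
    then have "0 \<le> ((cmod s)\<^sup>2 + 2 * Re (cnj t * s) * ?A + (cmod t)\<^sup>2 * ?A\<^sup>2) / ?A"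
      using A by (metis divide_nonneg_pos zero_le_power2)
    also have "\<dots> = (cmod s)\<^sup>2 / ?A + 2 * Re (cnj t * s) + (cmod t)\<^sup>2 * ?A"
      using A by (simp add: add_divide_distrib power2_eq_square)
    finally show ?thesis
      unfolding qform_schur[OF h] qform_extend[OF h] s_def[symmetric] by linarith
  qed
qed

lemma qform_schur_attained:
  assumes "psd k"
  obtains t where "Re (qform (schur k a) z c n) = Re (qform k (z(n := a)) (c(n := t)) (Suc n))"
proof -
  define s where "s = (\<Sum>i<n. c i * k (z i) a)"
  let ?A = "Re (k a a)"
  note h = psd_hermitian[OF assms]
  \<comment> \<open>The minimiser is \<open>- s / ?A\<close>. For a zero pivot it evaluates to 0,
    which still works because then \<open>s = 0\<close>.\<close>
  have "Re (qform (schur k a) z c n) = Re (qform k (z(n := a)) (c(n := - s / of_real ?A)) (Suc n))"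
  proof (cases "?A = 0")
    case True
    then show ?thesis
      unfolding qform_schur[OF h] qform_extend[OF h] s_def[symmetric] using psd_isotropic[OF assms True, of c z n, folded s_def] by simp
  next
    case False
    have "Re (cnj (- s / of_real ?A) * s) = - (cmod s)\<^sup>2 / ?A"
      by (simp add: cmod_power2) (simp add: power2_eq_square diff_divide_distrib add_divide_distrib)
    moreover have "(cmod (- s / of_real ?A))\<^sup>2 * ?A = (cmod s)\<^sup>2 / ?A"
      using False by (simp add: norm_divide power_divide power2_eq_square)
    ultimately show ?thesis
      unfolding qform_schur[OF h] qform_extend[OF h] s_def[symmetric] by linarith
  qed
then show thesis by (rule that)
qed

lemma psd_schur: "psd k \<Longrightarrow> psd (schur k a)"
  unfolding psd_def[of "schur k a"]
  by (metis hermitian_schur psd_def qform_schur_attained)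

text \<open>Both complements are minima over the coefficient at \<open>a\<close>, and the minimiser
  for \<open>k'\<close> is an admissible competitor for \<open>k\<close>.\<close>

lemma kernel_le_schur:
  assumes "psd k" "psd k'" "kernel_le k k'"
  shows "kernel_le (schur k a) (schur k' a)"
  unfolding kernel_le_def
proof (intro allI)
  fix z c n
  obtain t where t: "Re (qform (schur k' a) z c n) = Re (qform k' (z(n := a)) (c(n := t)) (Suc n))"
    using qform_schur_attained[OF assms(2)] by blast
  have "Re (qform (schur k a) z c n) \<le> Re (qform k (z(n := a)) (c(n := t)) (Suc n))"
    by (rule qform_schur_le[OF assms(1)])
  also have "\<dots> \<le> Re (qform k' (z(n := a)) (c(n := t)) (Suc n))"
    using assms(3) by (simp add: kernel_le_def)
  finally show "Re (qform (schur k a) z c n) \<le> Re (qform (schur k' a) z c n)" using t by simp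
qed

lemma gram_vol_snoc: "gram_vol k (xs @ [x]) = gram_vol k xs * Re (residual k xs x x)"
  by (induction xs arbitrary: k) auto

lemma gram_vol_nonneg: "psd k \<Longrightarrow> 0 \<le> gram_vol k xs"
  by (induction xs arbitrary: k) (auto simp: psd_diag psd_schur)

text \<open>The order passes to the Schur complements, so every pivot is monotone.\<close>

lemma gram_vol_mono:
  "psd k \<Longrightarrow> psd k' \<Longrightarrow> kernel_le k k' \<Longrightarrow> gram_vol k xs \<le> gram_vol k' xs"
proof (induction xs arbitrary: k k')
  case (Cons a xs)
  then show ?case
    by (simp add: mult_mono psd_diag psd_schur kernel_le_schur kernel_le_diag gram_vol_nonneg)
qed auto

lemma schur_diag_le:
  assumes "psd k"
  shows "Re (schur k a x x) \<le> Re (k x x)"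
  using qform_schur[OF psd_hermitian[OF assms], of a "\<lambda>_. x" "\<lambda>_. 1" 1] psd_diag[OF assms, of a]
  by (simp add: qform_def)

text \<open>Elimination only lowers the diagonal, so each pivot is bounded by an original diagonal
  entry.\<close>

lemma hadamard:
  assumes "psd k" "\<And>x. x \<in> set xs \<Longrightarrow> Re (k x x) \<le> B"
  shows "gram_vol k xs \<le> B ^ length xs"
  using assms
proof (induction xs arbitrary: k)
  case (Cons a xs)
  have "gram_vol (schur k a) xs \<le> B ^ length xs"
    using Cons.prems by (intro Cons.IH psd_schur) (auto intro: order_trans[OF schur_diag_le])
  moreover have "Re (k a a) \<le> B" "0 \<le> Re (k a a)"
    using Cons.prems by (auto intro: psd_diag)
  ultimately show ?case
    using Cons.prems(1) by (simp add: mult_mono gram_vol_nonneg psd_schur)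
qed auto

section \<open>Rank-one updates and the dependence of Gram determinants on the weights\<close>

definition add_rank_one :: "'a kernel \<Rightarrow> real \<Rightarrow> ('a \<Rightarrow> complex) \<Rightarrow> 'a kernel" where
  "add_rank_one k s v x y = k x y + of_real s * (v x * cnj (v y))"

lemma qform_add_rank_one:
  "qform (add_rank_one k s v) z c n = qform k z c n + of_real (s * (cmod (\<Sum>i<n. c i * v (z i)))\<^sup>2)"
proof -
  have "of_real (s * (cmod (\<Sum>i<n. c i * v (z i)))\<^sup>2)
      = (\<Sum>i<n. \<Sum>j<n. of_real s * (c i * v (z i) * cnj (c j * v (z j))))"
    unfolding of_real_mult complex_norm_square cnj_sum sum_product
    by (simp only: sum_distrib_left)
  then show ?thesis
    unfolding qform_def add_rank_one_def by (simp add: distrib_left sum.distrib mult_ac)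
qed

lemma psd_add_rank_one: "psd k \<Longrightarrow> 0 \<le> s \<Longrightarrow> psd (add_rank_one k s v)"
  unfolding psd_def qform_add_rank_one
proof (intro conjI allI)
  assume k: "hermitian k \<and> (\<forall>z c n. 0 \<le> Re (qform k z c n))" and s: "0 \<le> s"
  show "hermitian (add_rank_one k s v)"
    unfolding hermitian_def
  proof (intro allI)
    fix x y
    show "add_rank_one k s v y x = cnj (add_rank_one k s v x y)"
      unfolding add_rank_one_def hermitianD[OF conjunct1[OF k], where x = x and y = y]
      by (simp add: mult.commute)
  qed
  fix z c n
  show "0 \<le> Re (qform k z c n + of_real (s * (cmod (\<Sum>i<n. c i * v (z i)))\<^sup>2))"
    using k s by simp
qed

lemma psd_zero: "psd (\<lambda>_ _. 0)"
  by (simp add: psd_def hermitian_def qform_def)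

text \<open>Eliminating points where \<open>f\<close> vanishes does not change the rank-one kernel
  of \<open>f\<close>, and elimination preserves the order. This turns a bound on the residual into
  an error bound for functions with equal samples.\<close>

lemma residual_diag_ge:
  assumes "psd k" "kernel_le (rank_one f) k" "\<And>x. x \<in> set xs \<Longrightarrow> f x = 0"
  shows "(cmod (f y))\<^sup>2 \<le> Re (residual k xs y y)"
  using assms
proof (induction xs arbitrary: k)
  case Nil
  then show ?case using kernel_le_diag[OF Nil(2), of y] by (simp add: rank_one_diag)
next
  case (Cons a xs)
  have "rank_one f = add_rank_one (\<lambda>_ _. 0) 1 f"
    by (simp add: rank_one_def add_rank_one_def fun_eq_iff)
  then have psd1: "psd (rank_one f)" by (simp add: psd_add_rank_one psd_zero)
  have "schur (rank_one f) a = rank_one f"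
    using Cons.prems(3) by (auto simp: schur_def rank_one_def fun_eq_iff)
  then have "kernel_le (rank_one f) (schur k a)"
    using kernel_le_schur[OF psd1 Cons.prems(1,2), of a] by simp
  then show ?case
    using Cons by (auto intro!: Cons.IH psd_schur)
qed

text \<open>An identity of Sherman-Morrison type: elimination after a rank-one update is a rank-one
  update of the eliminated kernel, with \<open>v\<close> replaced by its own residual and the weight
  damped by the ratio of old to new pivot.\<close>

lemma schur_add_rank_one:
  assumes h: "hermitian k" and A: "Re (k a a) > 0" and s: "0 \<le> s"
  shows "schur (add_rank_one k s v) a =
    add_rank_one (schur k a) (s * Re (k a a) / (Re (k a a) + s * (cmod (v a))\<^sup>2))
      (\<lambda>x. v x - v a * k x a / k a a)"
proof (intro ext)
  fix x y
  let ?A = "Re (k a a)"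
  define b where "b = (cmod (v a))\<^sup>2"
  have kaa: "k a a = of_real ?A" by (rule hermitian_diag[OF h])
  have va: "v a * cnj (v a) = of_real b" by (simp add: b_def complex_norm_square del: of_real_power)
  have D: "?A + s * b > 0" using A s by (simp add: b_def add_pos_nonneg)
  define A' s' D' where "A' = complex_of_real ?A" and "s' = complex_of_real s" and "D' = A' + s' * of_real b"
  have nz: "A' \<noteq> 0" "D' \<noteq> 0" 
    using A D unfolding A'_def D'_def s'_def of_real_mult[symmetric] of_real_add[symmetric] of_real_eq_0_iff by auto
  have kay: "cnj (k y a) = k a y" using hermitianD[OF h, where y = a and x = y] by simp
  have D2: "D' - A' = s' * (v a * cnj (v a))" by (simp add: D'_def va)
  have e: "complex_of_real (s * ?A / (?A + s * b)) = s' * A' / D'"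
    by (simp add: A'_def s'_def D'_def)
  have "schur (add_rank_one k s v) a x y = k x y + s' * (v x * cnj (v y)) -
     (k x a + s' * (v x * cnj (v a))) * (k a y + s' * (v a * cnj (v y))) / D'"
    by (simp add: schur_def add_rank_one_def s'_def D'_def A'_def va kaa[symmetric])
  also have "\<dots> = k x y - k x a * k a y / A' + s' * A' / D' *
      ((v x - v a * k x a / A') * (cnj (v y) - cnj (v a) * k a y / A'))"
  proof -
    \<comment> \<open>Clearing both denominators reduces the claim to a polynomial identity.\<close>
    have "(A' * D') * (k x y + s' * (v x * cnj (v y)) -
     (k x a + s' * (v x * cnj (v a))) * (k a y + s' * (v a * cnj (v y))) / D') = 
      (A' * D') * (k x y - k x a * k a y / A' + s' * A' / D' *
      ((v x - v a * k x a / A') * (cnj (v y) - cnj (v a) * k a y / A')))"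
    proof -
      have l: "(A' * D') * (P - Q / D') = A' * (D' * P - Q)" for P Q using nz by (simp add: field_simps)
      have r: "(A' * D') * (P - Q / A' + s' * A' / D' * ((X - Y / A') * (Z - W / A')))
         = A' * D' * P - D' * Q + s' * ((A' * X - Y) * (A' * Z - W))" for P Q X Y Z W
        using nz by (simp add: field_simps)
      have D'': "D' = A' + s' * (v a * cnj (v a))" using D2 by (simp add: algebra_simps)
      show ?thesis unfolding l r unfolding D'' by algebra
    qed
    then show ?thesis using nz by simp
  qed
  also have "\<dots> = add_rank_one (schur k a) (s * ?A / (?A + s * b)) (\<lambda>x. v x - v a * k x a / k a a) x y"
    unfolding add_rank_one_def schur_def e by (simp add: kaa[folded A'_def] kay) (simp add: A'_def)
  finally show "schur (add_rank_one k s v) a x y =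
    add_rank_one (schur k a) (s * Re (k a a) / (Re (k a a) + s * (cmod (v a))\<^sup>2))
      (\<lambda>x. v x - v a * k x a / k a a) x y" by (simp add: b_def)
qed

text \<open>The matrix determinant lemma in the form needed: the determinant is affine in the weight
  with nonnegative slope. In the induction the new pivot cancels the denominator of the damped
  weight.\<close>

lemma gram_vol_add_rank_one:
  assumes "psd k"
  obtains c where "0 \<le> c" "\<And>s. 0 \<le> s \<Longrightarrow> gram_vol (add_rank_one k s v) xs = gram_vol k xs + s * c"
proof -
  have "\<exists>c\<ge>0. \<forall>s\<ge>0. gram_vol (add_rank_one k s v) xs = gram_vol k xs + s * c"
    using assms
  proof (induction xs arbitrary: k v)
    case Nil
    show ?case by (intro exI[of _ 0]) auto
  next
    case (Cons a xs)
    let ?A = "Re (k a a)" and ?b = "(cmod (v a))\<^sup>2"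
    note h = psd_hermitian[OF Cons.prems]
    have d: "Re (add_rank_one k s v a a) = ?A + s * ?b" for s
      unfolding add_rank_one_def cmod_power2 by (simp add: power2_eq_square)
    show ?case
    proof (cases "?A = 0")
      case True
      note z = psd_isotropic_row[OF Cons.prems True]
      \<comment> \<open>The old pivot is zero, so the whole pivot \<open>s * ?b\<close> comes from
        the update, and eliminating \<open>a\<close> removes the update again and gives back
        \<open>k\<close>.\<close>
      have "gram_vol (add_rank_one k s v) (a # xs) = gram_vol k (a # xs) + s * (?b * gram_vol k xs)"
        if "s \<ge> 0" for s
      proof (cases "s * ?b = 0")
        case True
        then show ?thesis using z(1)[of a] by (auto simp: d)
      next
        case False
        then have "schur (add_rank_one k s v) a = k"
          by (auto simp: schur_def add_rank_one_def fun_eq_iff z)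
        then show ?thesis using z(1)[of a] by (simp add: d)
      qed
      then show ?thesis
        using gram_vol_nonneg[OF Cons.prems]
        by (intro exI[of _ "?b * gram_vol k xs"]) auto
    next
      case False
      then have A: "?A > 0" using psd_diag[OF Cons.prems, of a] by simp
      obtain c where c: "c \<ge> 0" "\<And>s. s \<ge> 0 \<Longrightarrow>
         gram_vol (add_rank_one (schur k a) s (\<lambda>x. v x - v a * k x a / k a a)) xs
            = gram_vol (schur k a) xs + s * c"
        using Cons.IH[OF psd_schur[OF Cons.prems]] by metis
      have "gram_vol (add_rank_one k s v) (a # xs) =
          gram_vol k (a # xs) + s * (?b * gram_vol (schur k a) xs + ?A * c)" if s: "s \<ge> 0" for s
      proof -
        have D: "?A + s * ?b > 0" using A s by (simp add: add_pos_nonneg)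
        have "gram_vol (add_rank_one k s v) (a # xs) = (?A + s * ?b) *
            (gram_vol (schur k a) xs + s * ?A / (?A + s * ?b) * c)"
          using A s D by (simp add: d schur_add_rank_one[OF h A s] c(2))
        also have "\<dots> = (?A + s * ?b) * gram_vol (schur k a) xs + s * ?A * c"
          using D by (simp add: distrib_left)
        finally show ?thesis by (simp add: algebra_simps)
      qed
      then show ?thesis
        using gram_vol_nonneg[OF psd_schur[OF Cons.prems], of a xs] A c(1)
        by (intro exI[of _ "?b * gram_vol (schur k a) xs + ?A * c"]) auto
    qed
  qed
  then show ?thesis using that by blast
qed

definition add_rank_ones :: "'a kernel \<Rightarrow> (nat \<Rightarrow> real) \<Rightarrow> (nat \<Rightarrow> 'a \<Rightarrow> complex) \<Rightarrow> nat \<Rightarrow> 'a kernel" where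
  "add_rank_ones k w v q x y = k x y + (\<Sum>i<q. of_real (w i) * (v i x * cnj (v i y)))"

lemma add_rank_ones_0 [simp]: "add_rank_ones k w v 0 = k"
  by (simp add: add_rank_ones_def fun_eq_iff)

text \<open>The last summand can be split off as the outermost update or absorbed into the base
  kernel; the second form serves inductions that generalise the base.\<close>

lemma add_rank_ones_Suc:
  "add_rank_ones k w v (Suc q) = add_rank_one (add_rank_ones k w v q) (w q) (v q)"
  "add_rank_ones k w v (Suc q) = add_rank_ones (add_rank_one k (w q) (v q)) w v q"
  by (simp_all add: add_rank_ones_def add_rank_one_def fun_eq_iff algebra_simps)

lemma psd_add_rank_ones: "psd k \<Longrightarrow> (\<And>i. i < q \<Longrightarrow> 0 \<le> w i) \<Longrightarrow> psd (add_rank_ones k w v q)"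
  by (induction q) (auto simp: add_rank_ones_Suc(1) intro: psd_add_rank_one)

text \<open>In each weight the determinant is affine with nonnegative coefficients, so raising that
  weight from \<open>\<mu> i\<close> to \<open>w i\<close> costs at most the factor
  \<open>w i / \<mu> i\<close>. The weights are changed one at a time.\<close>

lemma gram_vol_rescale_le:
  assumes "psd k" "\<And>i. i < q \<Longrightarrow> 0 < \<mu> i" "\<And>i. i < q \<Longrightarrow> \<mu> i \<le> w i"
  shows "gram_vol (add_rank_ones k w v q) xs
    \<le> (\<Prod>i<q. w i / \<mu> i) * gram_vol (add_rank_ones k \<mu> v q) xs"
  using assms
proof (induction q arbitrary: k)
  case (Suc q)
  have w: "0 < \<mu> q" "\<mu> q \<le> w q" using Suc.prems by auto
  then have w0: "0 \<le> w q" by linarith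
  have "gram_vol (add_rank_ones k w v (Suc q)) xs
      \<le> (\<Prod>i<q. w i / \<mu> i) * gram_vol (add_rank_ones (add_rank_one k (w q) (v q)) \<mu> v q) xs"
    unfolding add_rank_ones_Suc(2) using Suc.prems w0 by (intro Suc.IH psd_add_rank_one) auto
  also have "add_rank_ones (add_rank_one k (w q) (v q)) \<mu> v q = add_rank_one (add_rank_ones k \<mu> v q) (w q) (v q)"
    by (simp add: add_rank_ones_def add_rank_one_def fun_eq_iff)
  also have "(\<Prod>i<q. w i / \<mu> i) * gram_vol (add_rank_one (add_rank_ones k \<mu> v q) (w q) (v q)) xs
      \<le> (\<Prod>i<q. w i / \<mu> i) *
          (w q / \<mu> q * gram_vol (add_rank_one (add_rank_ones k \<mu> v q) (\<mu> q) (v q)) xs)"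
  proof (rule mult_left_mono)
    show "0 \<le> (\<Prod>i<q. w i / \<mu> i)"
      using Suc.prems by (intro prod_nonneg) (meson divide_nonneg_pos lessThan_iff less_SucI less_imp_le order_trans)
    show "gram_vol (add_rank_one (add_rank_ones k \<mu> v q) (w q) (v q)) xs \<le> w q / \<mu> q * gram_vol (add_rank_one (add_rank_ones k \<mu> v q) (\<mu> q) (v q)) xs"
    proof -
    have p: "psd (add_rank_ones k \<mu> v q)"
      using Suc.prems by (intro psd_add_rank_ones) (auto intro: less_imp_le)
    obtain c where c: "0 \<le> c" "\<And>s. 0 \<le> s \<Longrightarrow>
        gram_vol (add_rank_one (add_rank_ones k \<mu> v q) s (v q)) xs = gram_vol (add_rank_ones k \<mu> v q) xs + s * c"
      using gram_vol_add_rank_one[OF p] by metis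
    \<comment> \<open>The linear part scales exactly by \<open>w q / \<mu> q\<close>; for the
      constant part it suffices that this ratio is at least 1.\<close>
    have "gram_vol (add_rank_ones k \<mu> v q) xs * 1 \<le> gram_vol (add_rank_ones k \<mu> v q) xs * (w q / \<mu> q)"
      using w gram_vol_nonneg[OF p] by (intro mult_left_mono) auto
    then show ?thesis using w w0 by (simp add: c algebra_simps)
    qed
  qed
  finally have "gram_vol (add_rank_ones k w v (Suc q)) xs \<le> (\<Prod>i<q. w i / \<mu> i) *
      (w q / \<mu> q * gram_vol (add_rank_ones k \<mu> v (Suc q)) xs)"
    by (simp only: add_rank_ones_Suc(1))
  then show ?case by (simp only: prod.lessThan_Suc mult.assoc)
qed auto

text \<open>Eliminating a point with nonzero pivot lowers the number of product terms by one, so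
  with more points than terms a zero pivot must occur.\<close>

lemma gram_vol_low_rank:
  assumes "finite J" "card J < length xs" "\<And>x y. k x y = (\<Sum>i\<in>J. f i x * g i y)"
  shows "gram_vol k xs = 0"
  using assms
proof (induction xs arbitrary: k J f g)
  case (Cons a xs)
  show ?case
  proof (cases "k a a = 0")
    case False
    then obtain j where j: "j \<in> J" "f j a \<noteq> 0"
      using Cons.prems(3)[of a a] by (metis (no_types, lifting) mult_zero_left sum.neutral)
    \<comment> \<open>The elimination is absorbed into the right factors. The eliminated kernel
      vanishes in the row of \<open>a\<close>, and this linear relation between the
      \<open>g'\<close> expresses the \<open>j\<close>-th one through the others.\<close>
    define g' where "g' i y = g i y - g i a * k a y / k a a" for i y
    define f' where "f' i x = f i x - f i a / f j a * f j x" for i x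
    have S: "schur k a x y = (\<Sum>i\<in>J. f i x * g' i y)" for x y
      unfolding schur_def g'_def Cons.prems(3)[of x]
      by (simp add: algebra_simps sum_subtractf sum_distrib_left sum_divide_distrib)
    have "(\<Sum>i\<in>J. f i a * g' i y) = 0" for y
      unfolding S[symmetric] using False by (simp add: schur_def)
    then have gj: "g' j y = - (\<Sum>i\<in>J - {j}. f i a * g' i y) / f j a" for y
      using j Cons.prems(1) by (simp add: sum.remove field_simps eq_neg_iff_add_eq_0)
    have "schur k a x y = (\<Sum>i\<in>J - {j}. f' i x * g' i y)" for x y
    proof -
      have "schur k a x y = f j x * g' j y + (\<Sum>i\<in>J - {j}. f i x * g' i y)"
        unfolding S using j Cons.prems(1) by (simp add: sum.remove)
      also have "\<dots> = (\<Sum>i\<in>J - {j}. f' i x * g' i y)"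
        unfolding gj f'_def
        by (simp add: algebra_simps sum_subtractf sum_distrib_left sum_divide_distrib)
      finally show ?thesis .
    qed
    moreover have "card (J - {j}) < length xs"
      using Cons.prems(1,2) j(1) card_Diff1_less[of J j] by simp
    ultimately have "gram_vol (schur k a) xs = 0"
      using Cons.prems(1) by (intro Cons.IH[of "J - {j}" _ f' g']) auto
    then show ?thesis by simp
  qed auto
qed auto

text \<open>With exactly \<open>q\<close> points, removing one of the \<open>q\<close> summands
  leaves too low a rank, so the affine dependence on each weight has no constant term.\<close>

lemma gram_vol_rescale_eq:
  assumes "length xs = q" "\<And>i. i < q \<Longrightarrow> 0 \<le> w i"
  shows "gram_vol (add_rank_ones (\<lambda>_ _. 0) w v q) xs
    = (\<Prod>i<q. w i) * gram_vol (add_rank_ones (\<lambda>_ _. 0) (\<lambda>_. 1) v q) xs"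
proof -
  \<comment> \<open>Interpolates between the weights 1 and \<open>w\<close>: the first
    \<open>j\<close> weights have already been exchanged.\<close>
  define W where "W j i = (if i < j then w i else 1)" for i j :: nat
  have "j \<le> q \<Longrightarrow> gram_vol (add_rank_ones (\<lambda>_ _. 0) (W j) v q) xs
     = (\<Prod>i<j. w i) * gram_vol (add_rank_ones (\<lambda>_ _. 0) (\<lambda>_. 1) v q) xs" for j
  proof (induction j)
    case 0
    then show ?case by (simp add: W_def)
  next
    case (Suc j)
    define k where "k = add_rank_ones (\<lambda>_ _. 0) ((W j)(j := 0)) v q"
    have eq: "add_rank_ones (\<lambda>_ _. 0) u v q = add_rank_one k (u j) (v j)"
      if "\<And>i. i \<noteq> j \<Longrightarrow> u i = W j i" for u
    proof (intro ext)
      fix x y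
      have "(\<Sum>i\<in>{..<q} - {j}. of_real (u i) * (v i x * cnj (v i y)))
          = (\<Sum>i\<in>{..<q} - {j}. of_real (((W j)(j := 0)) i) * (v i x * cnj (v i y)))"
        using that by (intro sum.cong) auto
      then show "add_rank_ones (\<lambda>_ _. 0) u v q x y = add_rank_one k (u j) (v j) x y"
        using Suc.prems by (simp add: add_rank_ones_def add_rank_one_def k_def sum.remove[of "{..<q}" j])
    qed
    have k: "psd k" unfolding k_def using assms(2)
      by (intro psd_add_rank_ones psd_zero) (auto simp: W_def)
    have k0: "gram_vol k xs = 0"
    proof (rule gram_vol_low_rank[where J = "{..<q} - {j}"])
      show "card ({..<q} - {j}) < length xs" using assms(1) Suc.prems by simp
      show "k x y = (\<Sum>i\<in>{..<q} - {j}. (of_real (((W j)(j := 0)) i) * v i x) * cnj (v i y))" for x y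
        using Suc.prems by (simp add: k_def add_rank_ones_def sum.remove[of "{..<q}" j] mult.assoc)
    qed auto
    obtain c where c: "\<And>s. 0 \<le> s \<Longrightarrow> gram_vol (add_rank_one k s (v j)) xs = s * c"
      using gram_vol_add_rank_one[OF k, of "v j" xs] k0 by auto
    have "gram_vol (add_rank_ones (\<lambda>_ _. 0) (W j) v q) xs = c"
      by (subst eq) (auto simp: c W_def)
    moreover have "gram_vol (add_rank_ones (\<lambda>_ _. 0) (W (Suc j)) v q) xs = w j * c"
      using assms(2) Suc.prems by (subst eq) (auto simp: c W_def less_Suc_eq)
    ultimately show ?case using Suc by (simp add: mult_ac)
  qed
  from this[of q] have "gram_vol (add_rank_ones (\<lambda>_ _. 0) (W q) v q) xs
    = (\<Prod>i<q. w i) * gram_vol (add_rank_ones (\<lambda>_ _. 0) (\<lambda>_. 1) v q) xs" by simp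
  moreover have "add_rank_ones (\<lambda>_ _. 0) (W q) v q = add_rank_ones (\<lambda>_ _. 0) w v q"
    by (simp add: add_rank_ones_def fun_eq_iff W_def)
  ultimately show ?thesis by simp
qed

section \<open>Projection matrices and the choice of points\<close>

definition proj_matrix :: "nat \<Rightarrow> nat kernel \<Rightarrow> bool" where
  "proj_matrix n p \<longleftrightarrow> hermitian p \<and> (\<forall>i l. (\<Sum>j<n. p i j * p j l) = p i l)"

text \<open>The projection of the vector that represents the functional with coefficients
  \<open>L\<close>.\<close>

definition proj_vec :: "nat \<Rightarrow> nat kernel \<Rightarrow> (nat \<Rightarrow> complex) \<Rightarrow> nat \<Rightarrow> complex" where
  "proj_vec n p L i = (\<Sum>j<n. p i j * cnj (L j))"

text \<open>The projection onto the part of the range of \<open>p\<close> on which the functional with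
  coefficients \<open>L\<close> vanishes.\<close>

definition proj_cut :: "nat \<Rightarrow> nat kernel \<Rightarrow> (nat \<Rightarrow> complex) \<Rightarrow> nat kernel" where
  "proj_cut n p L i j = p i j - proj_vec n p L i * cnj (proj_vec n p L j) / (\<Sum>l<n. L l * proj_vec n p L l)"

text \<open>All four follow from symmetry and idempotence. The last identifies the denominator in
  \<open>proj_cut\<close> as the squared norm of \<open>proj_vec\<close>, so \<open>proj_cut\<close>
  subtracts an orthogonal rank-one projection.\<close>

lemma proj_vec_facts:
  assumes "proj_matrix n p"
  shows "(\<Sum>i<n. L i * p i l) = cnj (proj_vec n p L l)"
    and "(\<Sum>j<n. p i j * proj_vec n p L j) = proj_vec n p L i"
    and "(\<Sum>j<n. cnj (proj_vec n p L j) * p j i) = cnj (proj_vec n p L i)"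
    and "(\<Sum>j<n. proj_vec n p L j * cnj (proj_vec n p L j)) = (\<Sum>l<n. L l * proj_vec n p L l)"
proof -
  have h: "cnj (p i j) = p j i" for i j
    using assms by (metis proj_matrix_def hermitian_def)
  show 1: "(\<Sum>i<n. L i * p i l) = cnj (proj_vec n p L l)" for l
    unfolding proj_vec_def by (simp add: h mult.commute)
  show 2: "(\<Sum>j<n. p i j * proj_vec n p L j) = proj_vec n p L i" for i
  proof -
    have "(\<Sum>j<n. p i j * proj_vec n p L j) = (\<Sum>j<n. \<Sum>l<n. p i j * p j l * cnj (L l))"
      by (simp add: proj_vec_def sum_distrib_left mult.assoc)
    also have "\<dots> = (\<Sum>l<n. (\<Sum>j<n. p i j * p j l) * cnj (L l))"
      by (subst sum.swap) (simp add: sum_distrib_right)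
    finally show ?thesis using assms by (simp add: proj_matrix_def proj_vec_def)
  qed
  show "(\<Sum>j<n. cnj (proj_vec n p L j) * p j i) = cnj (proj_vec n p L i)"
    unfolding 2[of i, symmetric] by (simp add: h mult.commute)
  have "(\<Sum>j<n. proj_vec n p L j * cnj (proj_vec n p L j)) = (\<Sum>j<n. \<Sum>l<n. L l * p l j * proj_vec n p L j)"
    unfolding 1[symmetric] by (simp add: sum_distrib_left sum_distrib_right mult.commute)
  also have "\<dots> = (\<Sum>l<n. L l * (\<Sum>j<n. p l j * proj_vec n p L j))"
    by (subst sum.swap) (simp add: sum_distrib_left mult.assoc)
  finally show "(\<Sum>j<n. proj_vec n p L j * cnj (proj_vec n p L j)) = (\<Sum>l<n. L l * proj_vec n p L l)"
    by (simp add: 2)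
qed

lemma proj_matrix_cut:
  assumes "proj_matrix n p"
  shows "proj_matrix n (proj_cut n p L)"
proof -
  define w where "w = proj_vec n p L"
  define N where "N = (\<Sum>l<n. L l * w l)"
  note f = proj_vec_facts[OF assms, where L = L, folded w_def, folded N_def]
  have h: "cnj (p i j) = p j i" for i j
    using assms by (metis proj_matrix_def hermitian_def)
  have c: "proj_cut n p L i j = p i j - w i * cnj (w j) / N" for i j
    by (simp add: proj_cut_def w_def N_def)
  have "cnj N = N" unfolding f(4)[symmetric] by (simp add: mult.commute)
  then have "hermitian (proj_cut n p L)"
    unfolding hermitian_def c by (simp add: h mult.commute)
  moreover have "(\<Sum>j<n. proj_cut n p L i j * proj_cut n p L j l) = proj_cut n p L i l" for i l
  proof -
    have "(\<Sum>j<n. proj_cut n p L i j * proj_cut n p L j l) =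
       (\<Sum>j<n. p i j * p j l) - (\<Sum>j<n. p i j * w j) * (cnj (w l) / N)
        - w i / N * (\<Sum>j<n. cnj (w j) * p j l) + w i / N * (\<Sum>j<n. w j * cnj (w j)) * (cnj (w l) / N)"
      unfolding sum_distrib_left sum_distrib_right sum_subtractf[symmetric] sum.distrib[symmetric] c
      by (intro sum.cong refl) (simp add: algebra_simps)
    also have "\<dots> = p i l - w i * cnj (w l) / N"
      unfolding f using assms by (simp add: proj_matrix_def)
    finally show ?thesis by (simp add: c)
  qed
  ultimately show ?thesis by (simp add: proj_matrix_def)
qed

text \<open>The subtracted part has trace \<open>N / N\<close>, which is 1, or 0 in the degenerate
  case \<open>N = 0\<close>.\<close>

lemma proj_cut_trace:
  assumes "proj_matrix n p"
  shows "Re (\<Sum>i<n. p i i) - 1 \<le> Re (\<Sum>i<n. proj_cut n p L i i)"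
proof -
  define w where "w = proj_vec n p L"
  define N where "N = (\<Sum>l<n. L l * w l)"
  note f = proj_vec_facts[OF assms, where L = L, folded w_def, folded N_def]
  have "(\<Sum>i<n. proj_cut n p L i i) = (\<Sum>i<n. p i i) - (\<Sum>i<n. w i * cnj (w i)) / N"
    by (simp add: proj_cut_def w_def N_def sum_subtractf sum_divide_distrib)
  also have "\<dots> = (\<Sum>i<n. p i i) - N / N" unfolding f ..
  finally have "Re (\<Sum>i<n. proj_cut n p L i i) = Re (\<Sum>i<n. p i i) - Re (N / N)"
    by (simp only: minus_complex.sel)
  moreover have "Re (N / N) \<le> 1" by (cases "N = 0") auto
  ultimately show ?thesis by linarith
qed

lemma proj_cut_annihilates:
  assumes "proj_matrix n p"
  shows "(\<Sum>i<n. L i * proj_cut n p L i l) = 0"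
    and "(\<And>l. (\<Sum>i<n. M i * p i l) = 0) \<Longrightarrow> (\<Sum>i<n. M i * proj_cut n p L i l) = 0"
proof -
  define w where "w = proj_vec n p L"
  define N where "N = (\<Sum>l<n. L l * w l)"
  note f = proj_vec_facts[OF assms, where L = L, folded w_def, folded N_def]
  have c: "(\<Sum>i<n. M i * proj_cut n p L i l) = (\<Sum>i<n. M i * p i l) - (\<Sum>i<n. M i * w i) * cnj (w l) / N" for M
    by (simp add: proj_cut_def w_def N_def right_diff_distrib sum_subtractf sum_divide_distrib sum_distrib_right mult.assoc)
  show "(\<Sum>i<n. L i * proj_cut n p L i l) = 0"
  proof (cases "N = 0")
    \<comment> \<open>Here the squared norm is zero, so \<open>w\<close> vanishes and
      \<open>L\<close> already annihilates the range of \<open>p\<close>.\<close>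
    case True
    have "l < n \<Longrightarrow> w l = 0" for l
    proof -
      assume l: "l < n"
      have "(\<Sum>j<n. (cmod (w j))\<^sup>2) = Re (\<Sum>j<n. w j * cnj (w j))"
        by (simp only: complex_norm_square[symmetric] Re_sum Re_complex_of_real)
      then have "(\<Sum>j<n. (cmod (w j))\<^sup>2) = 0" using f(4) True by simp
      then show ?thesis using l by (subst (asm) sum_nonneg_eq_0_iff) auto
    qed
    then have "w l = 0" unfolding f(2)[of l, symmetric] by simp
    then show ?thesis using c[of L] f(1)[of l] True by simp
  next
    case False
    then show ?thesis using c[of L] f(1)[of l] by (simp add: N_def[symmetric])
  qed
  show "(\<Sum>i<n. M i * proj_cut n p L i l) = 0" if M: "\<And>l. (\<Sum>i<n. M i * p i l) = 0"
  proof -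
    have "(\<Sum>i<n. M i * w i) = (\<Sum>j<n. (\<Sum>i<n. M i * p i j) * cnj (L j))"
      unfolding w_def proj_vec_def sum_distrib_left sum_distrib_right
      by (subst sum.swap) (simp add: mult.assoc)
    then show ?thesis using c[of M] M by simp
  qed
qed

definition id_matrix :: "nat \<Rightarrow> nat kernel" where
  "id_matrix n i j = (if i = j \<and> i < n then 1 else 0)"

lemma proj_id_matrix: "proj_matrix n (id_matrix n)"
proof -
  have "(\<Sum>j<n. id_matrix n i j * id_matrix n j l) = id_matrix n i l" for i l
  proof -
    have "(\<Sum>j<n. id_matrix n i j * id_matrix n j l) = (\<Sum>j<n. if j = i then id_matrix n i l else 0)"
      by (intro sum.cong) (auto simp: id_matrix_def)
    then show ?thesis by (simp add: id_matrix_def)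
  qed
  then show ?thesis by (auto simp: proj_matrix_def hermitian_def id_matrix_def)
qed

lemma trace_id_matrix: "(\<Sum>i<n. id_matrix n i i) = of_nat n"
  by (simp add: id_matrix_def)

text \<open>Starting from the identity, the functionals are cut off one after another. Each cut
  costs at most one unit of trace and keeps the earlier annihilations.\<close>

lemma proj_matrix_annihilating:
  obtains p where "proj_matrix n p" "real n - real m \<le> Re (\<Sum>i<n. p i i)"
    "\<And>j l. j < m \<Longrightarrow> (\<Sum>i<n. L j i * p i l) = 0"
proof -
  have "\<exists>p. proj_matrix n p \<and> real n - real m \<le> Re (\<Sum>i<n. p i i)
     \<and> (\<forall>j<m. \<forall>l. (\<Sum>i<n. L j i * p i l) = 0)"
  proof (induction m)
    case 0
    show ?case using proj_id_matrix[of n] trace_id_matrix[of n]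
      by (intro exI[of _ "id_matrix n"]) (simp del: Re_sum)
  next
    case (Suc m)
    then obtain p where p: "proj_matrix n p" "real n - real m \<le> Re (\<Sum>i<n. p i i)"
      "\<And>j l. j < m \<Longrightarrow> (\<Sum>i<n. L j i * p i l) = 0" by blast
    show ?case
      using proj_matrix_cut[OF p(1)] proj_cut_trace[OF p(1), of "L m"] p(2)
        proj_cut_annihilates[OF p(1)] p(3)
      by (intro exI[of _ "proj_cut n p (L m)"]) (auto simp: less_Suc_eq simp del: Re_sum)
  qed
  then show ?thesis using that by blast
qed

text \<open>Idempotence gives \<open>p i i\<close> as the squared norm of its row, which includes
  the square of \<open>p i i\<close> itself.\<close>

lemma proj_matrix_diag:
  assumes "proj_matrix n p" "i < n"
  shows "0 \<le> Re (p i i)" "Re (p i i) \<le> 1"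
proof -
  have h: "p j i = cnj (p i j)" for j
    using assms(1) by (metis proj_matrix_def hermitian_def)
  have "(\<Sum>j<n. p i j * p j i) = p i i"
    using assms(1) unfolding proj_matrix_def by blast
  moreover have "p i j * p j i = of_real ((cmod (p i j))\<^sup>2)" for j
    unfolding complex_norm_square by (subst h) simp
  ultimately have "p i i = of_real (\<Sum>j<n. (cmod (p i j))\<^sup>2)"
    by (simp only: of_real_sum)
  then have e: "Re (p i i) = (\<Sum>j<n. (cmod (p i j))\<^sup>2)" by (metis Re_complex_of_real)
  then show "0 \<le> Re (p i i)" by (simp add: sum_nonneg)
  have "(Re (p i i))\<^sup>2 \<le> (cmod (p i i))\<^sup>2" by (simp add: cmod_power2)
  also have "\<dots> \<le> Re (p i i)" unfolding e
    using assms(2) by (intro member_le_sum) auto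
  finally have "Re (p i i) * Re (p i i) \<le> Re (p i i)" by (simp only: power2_eq_square)
  then show "Re (p i i) \<le> 1"
    using mult_strict_left_mono[of 1 "Re (p i i)" "Re (p i i)"] by linarith
qed

definition mat_kernel :: "(nat \<Rightarrow> 'a \<Rightarrow> complex) \<Rightarrow> nat \<Rightarrow> nat kernel \<Rightarrow> 'a kernel" where
  "mat_kernel E n p x y = (\<Sum>i<n. \<Sum>j<n. p i j * E i x * cnj (E j y))"

text \<open>Eliminating a point is the same as cutting the projection by evaluation at that point,
  so these kernels are closed under elimination and the trace can be tracked.\<close>

lemma schur_mat_kernel:
  assumes "proj_matrix n p"
  shows "schur (mat_kernel E n p) a = mat_kernel E n (proj_cut n p (\<lambda>i. E i a))"
proof (intro ext)
  fix x y
  define w where "w = proj_vec n p (\<lambda>i. E i a)"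
  define N where "N = (\<Sum>l<n. E l a * w l)"
  note f = proj_vec_facts[OF assms, where L = "\<lambda>i. E i a", folded w_def, folded N_def]
  have 1: "mat_kernel E n p x a = (\<Sum>i<n. E i x * w i)" for x
    unfolding mat_kernel_def w_def proj_vec_def by (simp add: sum_distrib_left mult_ac)
  have 2: "mat_kernel E n p a y = (\<Sum>j<n. cnj (w j) * cnj (E j y))"
    unfolding mat_kernel_def f(1)[symmetric]
    by (subst sum.swap) (simp add: sum_distrib_left mult_ac)
  have "schur (mat_kernel E n p) a x y =
      mat_kernel E n p x y - (\<Sum>i<n. \<Sum>j<n. (E i x * w i) * (cnj (w j) * cnj (E j y))) / N"
    unfolding schur_def 2 unfolding 1 sum_product N_def[symmetric] ..
  also have "\<dots> = mat_kernel E n (proj_cut n p (\<lambda>i. E i a)) x y"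
    unfolding mat_kernel_def proj_cut_def w_def[symmetric] N_def[symmetric]
    by (simp add: algebra_simps sum_subtractf sum_divide_distrib)
  finally show "schur (mat_kernel E n p) a x y = mat_kernel E n (proj_cut n p (\<lambda>i. E i a)) x y" .
qed

section \<open>Reproducing kernels given by a weighted series of unimodular functions\<close>

definition series_kernel :: "(nat \<Rightarrow> real) \<Rightarrow> (nat \<Rightarrow> 'a \<Rightarrow> complex) \<Rightarrow> 'a kernel" where
  "series_kernel w E x y = (\<Sum>i. of_real (w i) * (E i x * cnj (E i y)))"

lemma series_kernel_sums:
  assumes "summable w" "\<And>i. 0 \<le> w i" "\<And>i x. cmod (E i x) = 1"
  shows "(\<lambda>i. of_real (w i) * (E i x * cnj (E i y))) sums series_kernel w E x y"
  unfolding series_kernel_def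
  by (intro summable_sums summable_norm_cancel[where f = "\<lambda>i. of_real (w i) * (E i x * cnj (E i y))"])
     (simp add: assms norm_mult)

lemma series_kernel_diag:
  assumes "summable w" "\<And>i. 0 \<le> w i" "\<And>i x. cmod (E i x) = 1"
  shows "Re (series_kernel w E x x) = (\<Sum>i. w i)"
proof -
  have "E i x * cnj (E i x) = 1" for i
    using complex_norm_square[of "E i x"] by (simp add: assms(3))
  then have "w sums Re (series_kernel w E x x)"
    using sums_Re[OF series_kernel_sums[where E = E and w = w, OF assms, where x = x and y = x]] by simp
  then show ?thesis by (simp add: sums_iff)
qed

lemma qform_series_kernel_sums:
  assumes "summable w" "\<And>i. 0 \<le> w i" "\<And>i x. cmod (E i x) = 1"
  shows "(\<lambda>i. w i * (cmod (\<Sum>a<(n::nat). c a * E i (z a)))\<^sup>2) sums Re (qform (series_kernel w E) z c n)"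
proof -
  have "(\<lambda>i. \<Sum>a<n. \<Sum>b<n. c a * cnj (c b) * (of_real (w i) * (E i (z a) * cnj (E i (z b)))))
      sums qform (series_kernel w E) z c n"
    unfolding qform_def by (intro sums_sum sums_mult series_kernel_sums assms)
  moreover have "(\<Sum>a<n. \<Sum>b<n. c a * cnj (c b) * (of_real (w i) * (E i (z a) * cnj (E i (z b)))))
      = of_real (w i * (cmod (\<Sum>a<n. c a * E i (z a)))\<^sup>2)" for i
    unfolding of_real_mult complex_norm_square cnj_sum sum_product
    by (simp add: sum_distrib_left mult_ac)
  ultimately show ?thesis using sums_Re by fastforce
qed

lemma psd_series_kernel:
  assumes "summable w" "\<And>i. 0 \<le> w i" "\<And>i x. cmod (E i x) = 1"
  shows "psd (series_kernel w E)"
proof -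
  have "series_kernel w E y x = cnj (series_kernel w E x y)" for x y
  proof -
    have "(\<lambda>i. of_real (w i) * (E i y * cnj (E i x))) sums cnj (series_kernel w E x y)"
      using sums_cnj[THEN iffD2, OF series_kernel_sums[where E = E and w = w, OF assms, where x = x and y = y]] by (simp add: mult.commute)
    then show ?thesis using series_kernel_sums[where E = E and w = w, OF assms, where x = y and y = x] sums_unique2 by blast
  qed
  moreover have "0 \<le> Re (qform (series_kernel w E) z c n)" for z c n
    using qform_series_kernel_sums[where E = E and w = w, OF assms, where n = n and c = c and z = z] by (rule sums_le[OF _ sums_zero, rotated]) (simp add: assms)
  ultimately show ?thesis unfolding psd_def hermitian_def by blast
qed

lemma series_kernel_split:
  assumes "summable w" "\<And>i. 0 \<le> w i" "\<And>i x. cmod (E i x) = 1"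
  shows "series_kernel w E = add_rank_ones (series_kernel (\<lambda>i. w (i + q)) (\<lambda>i. E (i + q))) w E q"
  by (intro ext)
     (simp add: series_kernel_def add_rank_ones_def
        suminf_split_initial_segment[OF sums_summable[OF series_kernel_sums[where E = E and w = w, OF assms]], where k = q])

text \<open>Cauchy-Schwarz: the bound on the partial sums says that \<open>h\<close> lies in the
  unit ball of the space with kernel \<open>series_kernel w E\<close>, and the rank-one kernel of
  such a function is dominated by the reproducing kernel.\<close>

lemma rank_one_le_series_kernel:
  assumes w: "summable w" "\<And>i. 0 < w i" "\<And>i x. cmod (E i x) = 1"
    and h: "\<And>x. (\<lambda>i. a i * E i x) sums h x"
    and a: "\<And>N. (\<Sum>i<N. (cmod (a i))\<^sup>2 / w i) \<le> 1"
  shows "kernel_le (rank_one h) (series_kernel w E)"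
  unfolding kernel_le_def
proof (intro allI)
  fix z c and n :: nat
  define S where "S i = (\<Sum>b<n. c b * E i (z b))" for i
  define Q where "Q = Re (qform (series_kernel w E) z c n)"
  have S: "(\<lambda>i. w i * (cmod (S i))\<^sup>2) sums Q"
    unfolding S_def Q_def using w by (intro qform_series_kernel_sums) (auto intro: less_imp_le)
  have "(\<lambda>i. \<Sum>b<n. c b * (a i * E i (z b))) sums (\<Sum>b<n. c b * h (z b))"
    by (intro sums_sum sums_mult h)
  moreover have "(\<lambda>i. \<Sum>b<n. c b * (a i * E i (z b))) = (\<lambda>i. a i * S i)"
    by (simp add: S_def sum_distrib_left mult_ac)
  ultimately have H: "(\<lambda>i. a i * S i) sums (\<Sum>b<n. c b * h (z b))" by simp
  have "(cmod (\<Sum>i<N. a i * S i))\<^sup>2 \<le> Q" for N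
  proof -
    \<comment> \<open>Each term is balanced by \<open>sqrt (w i)\<close>, so that Cauchy-Schwarz
      separates the norm of \<open>h\<close> from the quadratic form.\<close>
    have "cmod (\<Sum>i<N. a i * S i) \<le> (\<Sum>i<N. (cmod (a i) / sqrt (w i)) * (sqrt (w i) * cmod (S i)))"
      using w(2) by (intro order_trans[OF norm_sum] sum_mono) (simp add: norm_mult less_imp_neq[symmetric])
    then have "(cmod (\<Sum>i<N. a i * S i))\<^sup>2 \<le> (\<Sum>i<N. (cmod (a i) / sqrt (w i)) * (sqrt (w i) * cmod (S i)))\<^sup>2"
      by (intro power_mono) auto
    also have "\<dots> \<le> (\<Sum>i<N. (cmod (a i) / sqrt (w i))\<^sup>2) * (\<Sum>i<N. (sqrt (w i) * cmod (S i))\<^sup>2)"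
      by (rule Cauchy_Schwarz_ineq_sum)
    also have "\<dots> = (\<Sum>i<N. (cmod (a i))\<^sup>2 / w i) * (\<Sum>i<N. w i * (cmod (S i))\<^sup>2)"
      using w(2) by (simp add: power_divide power_mult_distrib less_imp_le)
    also have "\<dots> \<le> 1 * Q"
    proof (intro mult_mono a)
      show "(\<Sum>i<N. w i * (cmod (S i))\<^sup>2) \<le> Q"
        using S w(2) by (metis (no_types, lifting) sum_le_suminf finite_lessThan less_imp_le
            mult_nonneg_nonneg sums_iff zero_le_power2)
    qed (use w(2) in \<open>auto intro!: sum_nonneg simp: less_imp_le\<close>)
    finally show ?thesis by simp
  qed
  moreover have "(\<lambda>N. (cmod (\<Sum>i<N. a i * S i))\<^sup>2) \<longlonglongrightarrow> (cmod (\<Sum>b<n. c b * h (z b)))\<^sup>2"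
    using H unfolding sums_def by (intro tendsto_intros)
  ultimately have "(cmod (\<Sum>b<n. c b * h (z b)))\<^sup>2 \<le> Q"
    by (meson LIMSEQ_le_const2)
  moreover have "qform (rank_one h) z c n = of_real ((cmod (\<Sum>b<n. c b * h (z b)))\<^sup>2)"
    using qform_add_rank_one[of "\<lambda>_ _. 0" 1 h z c n]
    by (simp add: add_rank_one_def qform_def rank_one_def)
  ultimately show "Re (qform (rank_one h) z c n) \<le> Re (qform (series_kernel w E) z c n)"
    by (simp add: Q_def)
qed

lemma kernel_le_add_rank_ones:
  "kernel_le k k' \<Longrightarrow> kernel_le (add_rank_ones k w v q) (add_rank_ones k' w v q)"
  by (induction q) (auto simp: add_rank_ones_Suc(1) kernel_le_def qform_add_rank_one)

text \<open>Orthonormality enters only through \<open>mean\<close>: the average of such a double sum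
  over the domain is the trace of \<open>A\<close>, and some point reaches at least the
  average.\<close>

locale mean_orthonormal =
  fixes E :: "nat \<Rightarrow> 'a \<Rightarrow> complex" and D :: "'a set"
  assumes unimodular: "cmod (E i x) = 1"
    and mean: "\<exists>x\<in>D. Re (\<Sum>i<n. A i i) \<le> Re (\<Sum>i<n. \<Sum>j<n. A i j * E i x * cnj (E j x))"
begin

text \<open>Some point has pivot at least the trace, and eliminating it lowers the trace by at most
  one. The pivots are therefore at least \<open>r\<close>, \<open>r - 1\<close>, ..., 1, with
  product \<open>fact r\<close>.\<close>

lemma fekete_points:
  assumes "proj_matrix n p" "real r \<le> Re (\<Sum>i<n. p i i)"
  obtains xs where "length xs = r" "set xs \<subseteq> D" "fact r \<le> gram_vol (mat_kernel E n p) xs"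
proof -
  have "\<exists>xs. length xs = r \<and> set xs \<subseteq> D \<and> fact r \<le> gram_vol (mat_kernel E n p) xs"
    using assms
  proof (induction r arbitrary: p)
    case (Suc r)
    obtain x where x: "x \<in> D" "Re (\<Sum>i<n. p i i) \<le> Re (mat_kernel E n p x x)"
      using mean[of p n] unfolding mat_kernel_def by blast
    have "real r \<le> Re (\<Sum>i<n. proj_cut n p (\<lambda>i. E i x) i i)"
      using proj_cut_trace[OF Suc.prems(1), of "\<lambda>i. E i x"] Suc.prems(2) by linarith
    then obtain xs where xs: "length xs = r" "set xs \<subseteq> D"
      "fact r \<le> gram_vol (mat_kernel E n (proj_cut n p (\<lambda>i. E i x))) xs"
      using Suc.IH[OF proj_matrix_cut[OF Suc.prems(1)]] by blast
    have "real (Suc r) \<le> Re (mat_kernel E n p x x)"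
      using Suc.prems(2) x(2) by linarith
    then have "real (Suc r) * fact r \<le> gram_vol (mat_kernel E n p) (x # xs)"
      using xs(3) by (simp only: gram_vol.simps schur_mat_kernel[OF Suc.prems(1)])
         (intro mult_mono, auto)
    then show ?case
      using xs x(1) by (intro exI[of _ "x # xs"]) (simp add: fact_Suc)
  qed auto
  then show ?thesis using that by blast
qed

lemma good_points:
  fixes w :: "nat \<Rightarrow> real" and m :: nat
  assumes w: "summable w" "\<And>i. 0 < w i" "antimono w"
  defines "T \<equiv> (\<Sum>i. w (i + m))"
  obtains xs where "set xs \<subseteq> D" "length xs \<le> 2 * m"
    "\<And>x. x \<in> D \<Longrightarrow> Re (residual (series_kernel w E) xs x x) \<le> 36 * T"
proof -
  let ?K = "series_kernel w E"
  have w0: "0 \<le> w i" for i using w(2)[of i] by simp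
  have sm: "summable (\<lambda>i. w (i + q))" for q using w(1) by (simp add: summable_iff_shift)
  have Tpos: "T > 0" unfolding T_def by (rule suminf_pos[OF sm w(2)])
  have psdK: "psd ?K" by (intro psd_series_kernel w(1) w0 unimodular)
  have "\<exists>xs. set xs \<subseteq> D \<and> length xs \<le> 2 * m \<and>
      (\<forall>x\<in>D. Re (residual ?K xs x x) \<le> 36 * T)"
  proof (cases "m = 0")
    case True
    \<comment> \<open>Without points the residual is the full diagonal, which equals
      \<open>T\<close> when \<open>m = 0\<close>.\<close>
    then have "Re (?K x x) \<le> 36 * T" for x
      using series_kernel_diag[where w = w and E = E and x = x, OF w(1) w0 unimodular] Tpos by (simp add: T_def)
    then show ?thesis by (intro exI[of _ "[]"]) auto
  next
    case m0: False
    show ?thesis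
    proof (rule ccontr)
      assume neg: "\<not> ?thesis"
      define \<mu> where "\<mu> = T / m"
      have \<mu>: "\<mu> > 0" "m * \<mu> = T" using Tpos m0 by (auto simp: \<mu>_def)
      \<comment> \<open>The number of leading weights that are at least \<open>\<mu>\<close>, capped
        at \<open>m\<close>.\<close>
      define q where "q = (LEAST i. i = m \<or> w i < \<mu>)"
      have q1: "q = m \<or> w q < \<mu>" unfolding q_def by (rule LeastI[of _ m]) simp
      have qm: "q \<le> m" unfolding q_def by (rule Least_le) simp
      have q2: "\<mu> \<le> w i" if "i < q" for i
        using not_less_Least[of i "\<lambda>i. i = m \<or> w i < \<mu>"] that by (auto simp: q_def)
      have q3: "w i \<le> \<mu>" if "q \<le> i" "i < m" for i
        using q1 that antimonoD[OF w(3), of q i] by auto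
      define U where "U = series_kernel (\<lambda>i. w (i + q)) (\<lambda>i. E (i + q))"
      have psdU: "psd U" unfolding U_def by (intro psd_series_kernel sm w0 unimodular)
      have K: "?K = add_rank_ones U w E q"
        unfolding U_def by (intro series_kernel_split w(1) w0 unimodular)
      \<comment> \<open>The weights from \<open>q\<close> to \<open>m - 1\<close> are at most
        \<open>\<mu>\<close> each and contribute at most \<open>m * \<mu> = T\<close>; the remaining
        ones sum to \<open>T\<close>.\<close>
      have Udiag: "Re (U x x) \<le> 2 * T" for x
      proof -
        have "Re (U x x) = (\<Sum>i. w (i + q))"
          unfolding U_def by (intro series_kernel_diag sm w0 unimodular)
        also have "\<dots> = (\<Sum>i. w (i + (m - q) + q)) + (\<Sum>i<m - q. w (i + q))"
          by (rule suminf_split_initial_segment[OF sm])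
        also have "(\<Sum>i. w (i + (m - q) + q)) = T"
          using qm by (simp add: T_def)
        also have "(\<Sum>i<m - q. w (i + q)) \<le> (\<Sum>i<m - q. \<mu>)"
          by (intro sum_mono q3) auto
        also have "(\<Sum>i<m - q. \<mu>) \<le> m * \<mu>" using \<mu>(1) by simp
        finally show ?thesis using \<mu>(2) by linarith
      qed
      define P where "P = (\<Prod>i<q. w i)"
      have P: "P > 0" unfolding P_def by (intro prod_pos) (auto simp: w(2))
      have ext: "j \<le> 2 * m - q \<Longrightarrow> \<exists>xs. set xs \<subseteq> D \<and> length xs = q + j \<and>
          P * fact q * (36 * T) ^ j \<le> gram_vol ?K xs" for j
      proof (induction j)
        case 0
        \<comment> \<open>The identity matrix has trace \<open>q\<close>, so \<open>q\<close> points
          with determinant at least \<open>fact q\<close> exist for the first \<open>q\<close>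
          functions with unit weights.\<close>
        obtain xs where xs: "length xs = q" "set xs \<subseteq> D"
            "fact q \<le> gram_vol (mat_kernel E q (id_matrix q)) xs"
          using fekete_points[OF proj_id_matrix, of q q] trace_id_matrix[of q] by auto
        have "mat_kernel E q (id_matrix q) x y = add_rank_ones (\<lambda>_ _. 0) (\<lambda>_. 1) E q x y" for x y
        proof -
          have "(\<Sum>j<q. id_matrix q i j * E i x * cnj (E j y)) = E i x * cnj (E i y)" if "i < q" for i
          proof -
            have "(\<Sum>j<q. id_matrix q i j * E i x * cnj (E j y)) = (\<Sum>j<q. if j = i then E i x * cnj (E i y) else 0)"
              using that by (intro sum.cong) (auto simp: id_matrix_def)
            then show ?thesis using that by simp
          qed
          then show ?thesis by (simp add: mat_kernel_def add_rank_ones_def)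
        qed
        then have M: "mat_kernel E q (id_matrix q) = add_rank_ones (\<lambda>_ _. 0) (\<lambda>_. 1) E q" by blast
        have "P * fact q \<le> P * gram_vol (add_rank_ones (\<lambda>_ _. 0) (\<lambda>_. 1) E q) xs"
          using xs(3) P unfolding M by simp
        also have "\<dots> = gram_vol (add_rank_ones (\<lambda>_ _. 0) w E q) xs"
          unfolding P_def by (rule gram_vol_rescale_eq[symmetric, OF xs(1) w0])
        \<comment> \<open>Restoring the psd tail \<open>U\<close> can only increase the
          determinant.\<close>
        also have "\<dots> \<le> gram_vol ?K xs"
          unfolding K using psdU w0
          by (intro gram_vol_mono psd_add_rank_ones psd_zero kernel_le_add_rank_ones)
             (auto simp: kernel_le_def psd_def qform_def)
        finally show ?case using xs by (intro exI[of _ xs]) auto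
      next
        case (Suc j)
        then obtain xs where xs: "set xs \<subseteq> D" "length xs = q + j"
            "P * fact q * (36 * T) ^ j \<le> gram_vol ?K xs" by auto
        \<comment> \<open>The list still has at most \<open>2 * m\<close> points, so by the negated
          claim its residual is too large at some point; appending that point multiplies the
          determinant by this residual.\<close>
        then obtain x where x: "x \<in> D" "36 * T < Re (residual ?K xs x x)"
          using neg Suc.prems by (force simp: not_le)
        have "(P * fact q * (36 * T) ^ j) * (36 * T) \<le> gram_vol ?K xs * Re (residual ?K xs x x)"
          using xs(3) x(2) Tpos P by (intro mult_mono) (auto intro: gram_vol_nonneg[OF psdK])
        then show ?case
          using xs x by (intro exI[of _ "xs @ [x]"]) (auto simp: gram_vol_snoc mult_ac)
      qed
      obtain xs where xs: "length xs = 2 * m" "P * fact q * (36 * T) ^ (2 * m - q) \<le> gram_vol ?K xs"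
        using ext[of "2 * m - q"] qm by auto
      \<comment> \<open>The upper bound for the same determinant: lowering the large weights to
        \<open>\<mu>\<close> flattens the diagonal before Hadamard's inequality is applied.\<close>
      have "gram_vol ?K xs \<le> (\<Prod>i<q. w i / \<mu>) * gram_vol (add_rank_ones U (\<lambda>_. \<mu>) E q) xs"
        unfolding K using psdU \<mu>(1) q2 by (intro gram_vol_rescale_le) auto
      also have "\<dots> \<le> (\<Prod>i<q. w i / \<mu>) * (3 * T) ^ length xs"
      proof (intro mult_left_mono hadamard psd_add_rank_ones psdU)
        fix x
        have "E i x * cnj (E i x) = 1" for i
          using complex_norm_square[of "E i x"] by (simp add: unimodular)
        then have "Re (add_rank_ones U (\<lambda>_. \<mu>) E q x x) = Re (U x x) + q * \<mu>"
          by (simp add: add_rank_ones_def)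
        also have "real q * \<mu> \<le> T" using qm \<mu> by (metis mult_right_mono less_imp_le of_nat_le_iff)
        finally show "Re (add_rank_ones U (\<lambda>_. \<mu>) E q x x) \<le> 3 * T"
          using Udiag[of x] by linarith
      qed (use \<mu>(1) w0 in \<open>auto intro!: prod_nonneg\<close>)
      also have "(\<Prod>i<q. w i / \<mu>) = P / \<mu> ^ q" by (simp add: P_def prod_dividef)
      finally have "P * fact q * (36 * T) ^ (2 * m - q) \<le> P / \<mu> ^ q * (3 * T) ^ (2 * m)"
        using xs by simp
      then have "fact q * (36 * T) ^ (2 * m - q) * \<mu> ^ q \<le> (3 * T) ^ (2 * m)"
        using P \<mu>(1) by (simp add: field_simps)
      \<comment> \<open>Multiplying by \<open>m ^ q\<close> turns \<open>\<mu> ^ q\<close> into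
        \<open>T ^ q\<close>, after which all powers of \<open>T\<close> cancel.\<close>
      then have "fact q * (36 * T) ^ (2 * m - q) * \<mu> ^ q * real m ^ q \<le> (3 * T) ^ (2 * m) * real m ^ q"
        by (rule mult_right_mono) simp
      also have "fact q * (36 * T) ^ (2 * m - q) * \<mu> ^ q * real m ^ q = fact q * 36 ^ (2 * m - q) * T ^ (2 * m)"
      proof -
        have "\<mu> ^ q * real m ^ q = T ^ q"
          unfolding power_mult_distrib[symmetric] using \<mu>(2) by (simp add: mult.commute)
        moreover have "T ^ (2 * m - q) * T ^ q = T ^ (2 * m)"
          using qm by (simp add: power_add[symmetric])
        ultimately show ?thesis by (simp add: power_mult_distrib mult.assoc)
      qed
      also have "(3 * T) ^ (2 * m) * real m ^ q = (9 ^ m * real m ^ q) * T ^ (2 * m)"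
        by (simp add: power_mult_distrib power_mult)
      finally have "fact q * 36 ^ (2 * m - q) \<le> 9 ^ m * real m ^ q"
        using Tpos by simp
      \<comment> \<open>\<open>m ^ q / fact q\<close> is one term of the exponential series of
        \<open>m\<close>, and \<open>exp 1 \<le> 3\<close>.\<close>
      moreover have "real m ^ q \<le> fact q * 3 ^ m"
      proof -
        have "real m ^ q /\<^sub>R fact q \<le> exp (real m)"
          unfolding exp_def
          using sum_le_suminf[OF summable_exp_generic[of "real m"], of "{q}"] by simp
        also have "exp (real m) = exp 1 ^ m" by (simp add: exp_of_nat_mult[symmetric])
        also have "\<dots> \<le> (3::real) ^ m" by (intro power_mono exp_le) simp
        finally show ?thesis by (simp add: field_simps)
      qed
      ultimately have "fact q * 36 ^ (2 * m - q) \<le> 9 ^ m * (fact q * (3::real) ^ m)"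
        by (meson mult_left_mono order_trans zero_le_numeral zero_le_power)
      then have "fact q * (36::real) ^ (2 * m - q) \<le> fact q * (9 ^ m * 3 ^ m)"
        by (simp add: mult_ac)
      \<comment> \<open>Since \<open>2 * m - q \<ge> m\<close>, any constant above 27 contradicts
        this; 36 is chosen with an integral square root.\<close>
      then have "(36::real) ^ (2 * m - q) \<le> 9 ^ m * 3 ^ m"
        by simp
      also have "\<dots> = (27::real) ^ m" by (simp add: power_mult_distrib[symmetric])
      also have "\<dots> < 36 ^ m" using m0 by (intro power_strict_mono) auto
      also have "\<dots> \<le> (36::real) ^ (2 * m - q)" using qm by (intro power_increasing) auto
      finally show False by simp
    qed
  qed
  then show ?thesis using that by blast
qed

end

section \<open>Characters on the torus\<close>

text \<open>Summability makes the superlevel sets finite, so a maximum exists after removing any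
  finite set. Picking maxima repeatedly exhausts \<open>S\<close>: an omitted element would have
  infinitely many picks above it.\<close>

lemma decreasing_enumeration:
  fixes g :: "'a \<Rightarrow> real"
  assumes inf: "infinite S" and pos: "\<And>x. x \<in> S \<Longrightarrow> 0 < g x" and sm: "g summable_on S"
  obtains \<sigma> :: "nat \<Rightarrow> 'a" where "bij_betw \<sigma> UNIV S" "antimono (\<lambda>i. g (\<sigma> i))"
proof -
  have fin: "finite {x \<in> S. t \<le> g x}" if "t > 0" for t
  proof (rule ccontr)
    assume i: "infinite {x \<in> S. t \<le> g x}"
    obtain N :: nat where N: "infsum g S < N * t"
      using reals_Archimedean3[OF \<open>t > 0\<close>] by blast
    obtain F where F: "finite F" "card F = N" "F \<subseteq> {x \<in> S. t \<le> g x}"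
      using infinite_arbitrarily_large[OF i] by blast
    have "N * t = (\<Sum>x\<in>F. t)" using F(2) by simp
    also have "\<dots> \<le> sum g F" using F(3) by (intro sum_mono) auto
    also have "\<dots> \<le> infsum g S"
      using F sm pos by (intro finite_sum_le_infsum) (auto simp: less_imp_le)
    finally show False using N by simp
  qed
  have mx: "\<exists>x\<in>S - A. \<forall>y\<in>S - A. g y \<le> g x" if A: "finite A" for A
  proof -
    obtain x0 where x0: "x0 \<in> S - A" using inf A by (metis finite_Diff2 finite.emptyI equals0I)
    \<comment> \<open>Only elements at least as large as one fixed candidate compete, and these are
      finitely many.\<close>
    let ?M = "{x \<in> S. g x0 \<le> g x} - A"
    have M: "finite ?M" "?M \<noteq> {}" using fin[of "g x0"] pos x0 by auto
    then have "Max (g ` ?M) \<in> g ` ?M" by (intro Max_in) auto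
    then obtain x where x: "x \<in> ?M" "Max (g ` ?M) = g x" by blast
    have ge: "g y \<le> g x" if "y \<in> ?M" for y
      unfolding x(2)[symmetric] by (intro Max_ge finite_imageI M imageI that)
    have "g y \<le> g x" if "y \<in> S - A" for y
    proof (cases "g x0 \<le> g y")
      case True
      then show ?thesis using that by (intro ge) auto
    next
      case False
      then show ?thesis using ge[of x0] x0 by auto
    qed
    then show ?thesis using x(1) by blast
  qed
  define pick where "pick A = (SOME x. x \<in> S - A \<and> (\<forall>y\<in>S - A. g y \<le> g x))" for A
  have pick: "pick A \<in> S - A" "\<And>y. y \<in> S - A \<Longrightarrow> g y \<le> g (pick A)" if "finite A" for A
    using someI_ex[of "\<lambda>x. x \<in> S - A \<and> (\<forall>y\<in>S - A. g y \<le> g x)"] mx[OF that]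
    unfolding pick_def by blast+
  \<comment> \<open>\<open>B n\<close> collects the first \<open>n\<close> picks; recursion on the
    set makes the choice of the next element a function of the previous ones.\<close>
  define B where "B = rec_nat {} (\<lambda>_ A. insert (pick A) A)"
  have B0: "B 0 = {}" and BS: "B (Suc n) = insert (pick (B n)) (B n)" for n
    by (simp_all add: B_def)
  have Bf: "finite (B n)" for n by (induction n) (auto simp: B0 BS)
  define \<sigma> where "\<sigma> n = pick (B n)" for n
  have B: "B n = \<sigma> ` {..<n}" for n
    by (induction n) (auto simp: B0 BS \<sigma>_def lessThan_Suc)
  have \<sigma>S: "\<sigma> n \<in> S" and \<sigma>n: "\<sigma> n \<notin> \<sigma> ` {..<n}" for n
    using pick(1)[OF Bf, of n, folded \<sigma>_def] unfolding B by auto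
  have inj: "inj \<sigma>"
  proof (rule injI)
    fix i j assume "\<sigma> i = \<sigma> j"
    then show "i = j" using \<sigma>n[of i] \<sigma>n[of j] by (metis imageI lessThan_iff linorder_neqE_nat)
  qed
  have dec: "g y \<le> g (\<sigma> n)" if "y \<in> S" "y \<notin> \<sigma> ` {..<n}" for y n
    using pick(2)[OF Bf, of y n, folded \<sigma>_def] that unfolding B by auto
  have mono: "antimono (\<lambda>i. g (\<sigma> i))"
    unfolding antimono_iff_le_Suc
  proof
    fix n show "g (\<sigma> (Suc n)) \<le> g (\<sigma> n)"
      using \<sigma>n[of "Suc n"] by (intro dec \<sigma>S) (auto simp: lessThan_Suc)
  qed
  have "x \<in> range \<sigma>" if "x \<in> S" for x
  proof (rule ccontr)
    assume "x \<notin> range \<sigma>"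
    then have "g x \<le> g (\<sigma> n)" for n using that by (intro dec) auto
    then have "range \<sigma> \<subseteq> {y \<in> S. g x \<le> g y}" using \<sigma>S by auto
    then have "finite (range \<sigma>)" using fin[OF pos[OF that]] finite_subset by blast
    then show False using inj finite_imageD infinite_UNIV_nat by blast
  qed
  then have "bij_betw \<sigma> UNIV S" using inj \<sigma>S by (auto simp: bij_betw_def)
  then show ?thesis using mono that by blast
qed

text \<open>For \<open>t > 0\<close> at least \<open>n + 1\<close> weights reach \<open>t\<close>
  exactly when \<open>t \<le> w n\<close>, so the supremum runs over \<open>{0<..w n}\<close>. The
  index shift arises because \<open>lam\<close> counts from 1 and the enumeration from 0.\<close>

lemma lam_enumeration:
  assumes bij: "bij_betw \<sigma> UNIV (freqs d)" and mono: "antimono (\<lambda>i. 1 / (\<omega> (\<sigma> i))\<^sup>2)"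
    and pos: "\<And>i. 0 < 1 / (\<omega> (\<sigma> i))\<^sup>2" and sm: "summable (\<lambda>i. 1 / (\<omega> (\<sigma> i))\<^sup>2)"
  shows "lam d \<omega> (Suc n) = 1 / (\<omega> (\<sigma> n))\<^sup>2"
proof -
  define w where "w i = 1 / (\<omega> (\<sigma> i))\<^sup>2" for i
  have w0: "w i > 0" for i using pos by (simp add: w_def)
  have wm: "i \<le> j \<Longrightarrow> w j \<le> w i" for i j using antimonoD[OF mono] by (simp add: w_def)
  have "(Suc n \<le> card {j \<in> freqs d. t \<le> 1 / (\<omega> j)\<^sup>2}) = (t \<le> w n)" if t: "t > 0" for t
  proof -
    have inj: "inj_on \<sigma> A" for A using bij by (meson bij_betw_def inj_on_subset subset_UNIV)
    have "{j \<in> freqs d. t \<le> 1 / (\<omega> j)\<^sup>2} = \<sigma> ` {i. t \<le> w i}"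
      using bij unfolding bij_betw_def w_def by auto
    then have c: "card {j \<in> freqs d. t \<le> 1 / (\<omega> j)\<^sup>2} = card {i. t \<le> w i}"
      by (simp add: card_image[OF inj])
    have "w \<longlonglongrightarrow> 0" unfolding w_def by (rule summable_LIMSEQ_zero[OF sm])
    then obtain N where N: "\<And>i. i \<ge> N \<Longrightarrow> w i < t"
      using t by (metis (no_types, lifting) eventually_sequentially order_tendstoD(2))
    then have "{i. t \<le> w i} \<subseteq> {..<N}" by (force simp: not_le[symmetric])
    then have fin: "finite {i. t \<le> w i}" using finite_subset by blast
    show ?thesis unfolding c
    proof
      assume "t \<le> w n"
      then have "{..n} \<subseteq> {i. t \<le> w i}" using wm by (auto intro: order_trans)
      then show "Suc n \<le> card {i. t \<le> w i}" using card_mono[OF fin, of "{..n}"] by simp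
    next
      assume s: "Suc n \<le> card {i. t \<le> w i}"
      show "t \<le> w n"
      proof (rule ccontr)
        assume "\<not> t \<le> w n"
        then have "{i. t \<le> w i} \<subseteq> {..<n}"
          using wm[of n] by (force simp: not_le)
        then have "card {i. t \<le> w i} \<le> n" using card_mono[of "{..<n}" "{i. t \<le> w i}"] by simp
        then show False using s by simp
      qed
    qed
  qed
  then have "{t. t > 0 \<and> Suc n \<le> card {j \<in> freqs d. t \<le> 1 / (\<omega> j)\<^sup>2}} = {0<..w n}"
    by auto
  then show ?thesis unfolding lam_def using w0[of n] by (simp add: w_def[symmetric])
qed

lemma infinite_freqs:
  assumes "d \<ge> 1"
  shows "infinite (freqs d)"
proof
  assume "finite (freqs d)"
  moreover have "(\<lambda>(a::int) i. if i = (0::nat) then a else 0) ` UNIV \<subseteq> freqs d"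
    using assms by (auto simp: freqs_def)
  moreover have "inj (\<lambda>(a::int) i. if i = (0::nat) then a else 0)"
    by (rule injI) (metis (full_types))
  ultimately show False using finite_subset finite_imageD infinite_UNIV_int by blast
qed

section \<open>The torus as a probability space and the orthonormality of its characters\<close>

lemma prob_space_unit_interval: "prob_space (restrict_space lborel {0..1::real})"
  by (rule prob_spaceI) (simp add: emeasure_restrict_space space_restrict_space)

lemma prob_space_torus: "prob_space (torus d)"
  unfolding torus_def by (intro prob_space_PiM prob_space_unit_interval)

lemma product_sigma_finite_unit_interval: "product_sigma_finite (\<lambda>_. restrict_space lborel {0..1::real})"
  by (simp add: product_sigma_finite_def prob_space_imp_sigma_finite prob_space_unit_interval)

lemma space_torus: "space (torus d) = {..<d} \<rightarrow>\<^sub>E {0..1}"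
  by (simp add: torus_def space_PiM space_restrict_space)

definition char :: "nat \<Rightarrow> (nat \<Rightarrow> int) \<Rightarrow> (nat \<Rightarrow> real) \<Rightarrow> complex" where
  "char d k x = exp (2 * complex_of_real pi * \<i> * complex_of_real (dotk d k x))"

lemma char_cis: "char d k x = cis (2 * pi * dotk d k x)"
  by (simp add: char_def cis_conv_exp mult_ac)

lemma norm_char [simp]: "cmod (char d k x) = 1"
  by (simp add: char_cis)

lemma char_mult_cnj: "char d k x * cnj (char d l x) = char d (\<lambda>i. k i - l i) x"
  by (simp add: char_cis cis_cnj cis_mult dotk_def sum_subtractf left_diff_distrib right_diff_distrib)

lemma fhat_char: "fhat d f k = integral\<^sup>L (torus d) (\<lambda>x. f x * cnj (char d k x))"
  by (simp add: fhat_def char_def exp_cnj mult_ac)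

lemma integral_unit_interval_exp:
  "integral\<^sup>L (restrict_space lborel {0..1}) (\<lambda>x. cis (2 * pi * (of_int k * x))) = (if k = 0 then 1 else 0)"
proof -
  have "integral\<^sup>L (restrict_space lborel {0..1}) (\<lambda>x. cis (2 * pi * (of_int k * x)))
     = integral\<^sup>L lborel (\<lambda>x. indicator {0..1} x *\<^sub>R cis (2 * pi * (of_int k * x)))"
    by (rule integral_restrict_space) simp
  also have "\<dots> = (if k = 0 then 1 else 0)"
  proof (cases "k = 0")
    case True
    then show ?thesis by simp
  next
    case False
    define c where "c = 2 * pi * of_int k"
    have c: "c \<noteq> 0" using False by (simp add: c_def)
    have "integral\<^sup>L lborel (\<lambda>x. indicator {0..1} x *\<^sub>R cis (c * x))
        = cis (c * 1) / (\<i> * of_real c) - cis (c * 0) / (\<i> * of_real c)"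
    proof (rule integral_FTC_atLeastAtMost)
      fix x :: real
      have "((\<lambda>x. cis (c * x) / (\<i> * of_real c)) has_vector_derivative
          ((\<i> * of_real c) * cis (c * x)) / (\<i> * of_real c)) (at x within {0..1})"
      proof -
        have "((\<lambda>z. exp (\<i> * of_real c * z) / (\<i> * of_real c)) has_field_derivative
            ((\<i> * of_real c) * exp (\<i> * of_real c * of_real x)) / (\<i> * of_real c)) (at (of_real x))"
          using c by (auto intro!: derivative_eq_intros)
        from has_vector_derivative_real_field[OF this]
        show ?thesis by (simp add: cis_conv_exp mult.assoc)
      qed
      then show "((\<lambda>x. cis (c * x) / (\<i> * of_real c)) has_vector_derivative cis (c * x)) (at x within {0..1})"
        using c by simp
    qed (auto intro!: continuous_intros)
    also have "cis (c * 1) = 1" by (simp add: c_def cis_multiple_2pi)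
    finally show ?thesis using False by (simp add: c_def mult.assoc)
  qed
  finally show ?thesis .
qed

lemma char_prod: "char d k x = (\<Prod>i<d. cis (2 * pi * (of_int (k i) * x i)))"
  unfolding char_cis dotk_def
  by (induction d) (simp_all add: cis_mult[symmetric] distrib_left)

lemma component_measurable_torus [measurable]: "i < d \<Longrightarrow> (\<lambda>x. x i) \<in> borel_measurable (torus d)"
proof -
  assume i: "i < d"
  have "(\<lambda>x. x i) \<in> measurable (torus d) (restrict_space lborel {0..1::real})"
    unfolding torus_def using i by (intro measurable_component_singleton) auto
  then show ?thesis
    by (simp add: measurable_restrict_space2_iff)
qed

lemma char_measurable [measurable]: "char d k \<in> borel_measurable (torus d)"
proof -
  have [measurable]: "dotk d k \<in> borel_measurable (torus d)"
    unfolding dotk_def by (intro borel_measurable_sum borel_measurable_times component_measurable_torus) auto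
  show ?thesis unfolding char_def by measurable
qed

lemma char_integrable: "integrable (torus d) (char d k)"
proof -
  interpret prob_space "torus d" by (rule prob_space_torus)
  show ?thesis by (rule integrable_const_bound[of _ 1]) auto
qed

lemma integral_char:
  assumes "k \<in> freqs d"
  shows "integral\<^sup>L (torus d) (char d k) = (if k = (\<lambda>_. 0) then 1 else 0)"
proof -
  interpret product_sigma_finite "\<lambda>_. restrict_space lborel {0..1::real}"
    by (rule product_sigma_finite_unit_interval)
  interpret P: prob_space "restrict_space lborel {0..1::real}" by (rule prob_space_unit_interval)
  have "(\<lambda>x. cis (2 * pi * (of_int k * x))) \<in> borel_measurable (restrict_space lborel {0..1})" for k
    by (intro measurable_restrict_space1) (simp add: borel_measurable_continuous_onI continuous_intros)
  then have int: "integrable (restrict_space lborel {0..1}) (\<lambda>x. cis (2 * pi * (of_int k * x)))" for k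
    by (intro P.integrable_const_bound[of _ 1]) auto
  have "integral\<^sup>L (torus d) (char d k) = (\<Prod>i<d. if k i = 0 then 1 else 0)"
    unfolding char_prod[abs_def] torus_def
    by (subst product_integral_prod) (auto simp: int integral_unit_interval_exp)
  \<comment> \<open>Membership in \<open>freqs d\<close> is what turns vanishing on the first
    \<open>d\<close> coordinates into being the zero function.\<close>
  also have "\<dots> = (if k = (\<lambda>_. 0) then 1 else 0)"
    using assms by (auto simp: freqs_def fun_eq_iff prod_zero_iff) (metis lessThan_iff not_le)
  finally show ?thesis .
qed

lemma integral_char_mult_cnj:
  assumes "k \<in> freqs d" "l \<in> freqs d"
  shows "integral\<^sup>L (torus d) (\<lambda>x. char d k x * cnj (char d l x)) = (if k = l then 1 else 0)"
proof -
  have "(\<lambda>i. k i - l i) \<in> freqs d" using assms by (simp add: freqs_def)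
  then show ?thesis
    unfolding char_mult_cnj by (subst integral_char) (auto simp: fun_eq_iff)
qed

text \<open>Integration kills the off-diagonal terms and leaves the trace, and on a probability
  space a function cannot lie strictly below its mean everywhere.\<close>

lemma mean_orthonormal_char:
  assumes bij: "bij_betw \<sigma> UNIV (freqs d)"
  shows "mean_orthonormal (\<lambda>i. char d (\<sigma> i)) (space (torus d))"
proof
  interpret prob_space "torus d" by (rule prob_space_torus)
  fix A :: "nat \<Rightarrow> nat \<Rightarrow> complex" and n
  let ?G = "\<lambda>x. \<Sum>i<n. \<Sum>j<n. A i j * char d (\<sigma> i) x * cnj (char d (\<sigma> j) x)"
  have \<sigma>: "\<sigma> i \<in> freqs d" "\<sigma> i = \<sigma> j \<longleftrightarrow> i = j" for i j
    using bij by (auto simp: bij_betw_def inj_eq)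
  have int1: "integrable (torus d) (\<lambda>x. char d (\<sigma> i) x * cnj (char d (\<sigma> j) x))" for i j
    unfolding char_mult_cnj by (rule char_integrable)
  then have int: "integrable (torus d) ?G"
    unfolding mult.assoc by (intro Bochner_Integration.integrable_sum integrable_mult_right)
  have "integral\<^sup>L (torus d) ?G = (\<Sum>i<n. \<Sum>j<n. A i j * (if i = j then 1 else 0))"
    unfolding mult.assoc using int1
    by (simp add: Bochner_Integration.integral_sum Bochner_Integration.integrable_sum
        integral_char_mult_cnj \<sigma>)
  also have "\<dots> = (\<Sum>i<n. A i i)" by (simp add: if_distrib cong: if_cong)
  finally have I: "integral\<^sup>L (torus d) (\<lambda>x. Re (?G x)) = Re (\<Sum>i<n. A i i)"
    using integral_Re[OF int] by simp
  show "\<exists>x\<in>space (torus d). Re (\<Sum>i<n. A i i) \<le> Re (?G x)"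
  proof (rule ccontr)
    assume "\<not> ?thesis"
    then have "AE x in torus d. Re (?G x) < Re (\<Sum>i<n. A i i)"
      by (intro AE_I2) (auto simp: not_le)
    then have "integral\<^sup>L (torus d) (\<lambda>x. Re (?G x)) < Re (\<Sum>i<n. A i i)"
      by (intro expectation_less integrable_Re int)
    then show False using I by simp
  qed
qed simp

section \<open>Sampling and approximation numbers\<close>

text \<open>The box around \<open>x0\<close>, clipped to the unit cube, has positive measure even
  when \<open>x0\<close> lies on the boundary, so it is not contained in a null set.\<close>

lemma torus_box_meets_AE:
  assumes x0: "x0 \<in> space (torus d)" and "\<delta> > 0" and P: "AE x in torus d. P x"
  shows "\<exists>y\<in>space (torus d). P y \<and> (\<forall>i<d. \<bar>y i - x0 i\<bar> \<le> \<delta>)"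
proof -
  interpret product_sigma_finite "\<lambda>_. restrict_space lborel {0..1::real}"
    by (rule product_sigma_finite_unit_interval)
  define A where "A i = {max 0 (x0 i - \<delta>)..min 1 (x0 i + \<delta>)}" for i
  have x0i: "0 \<le> x0 i" "x0 i \<le> 1" if "i < d" for i
    using x0 that by (auto simp: space_torus PiE_iff)
  have A01: "A i \<subseteq> {0..1}" for i by (auto simp: A_def)
  have As: "A i \<in> sets (restrict_space lborel {0..1})" for i
    using A01[of i] by (auto simp: sets_restrict_space_iff A_def)
  have pos: "emeasure (restrict_space lborel {0..1}) (A i) > 0" if "i < d" for i
  proof -
    have "emeasure (restrict_space lborel {0..1}) (A i) = emeasure lborel (A i)"
      by (rule emeasure_restrict_space) (use A01 in auto)
    also have "\<dots> = ennreal (min 1 (x0 i + \<delta>) - max 0 (x0 i - \<delta>))"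
      unfolding A_def using x0i[OF that] \<open>\<delta> > 0\<close> by (intro emeasure_lborel_Icc) auto
    finally show ?thesis using x0i[OF that] \<open>\<delta> > 0\<close> by auto
  qed
  have "emeasure (torus d) (Pi\<^sub>E {..<d} A) \<noteq> 0"
    unfolding torus_def using pos by (subst emeasure_PiM) (force simp: As prod_zero_iff)+
  moreover obtain N where N: "{x \<in> space (torus d). \<not> P x} \<subseteq> N" "emeasure (torus d) N = 0" "N \<in> sets (torus d)"
    using AE_E[OF P] by metis
  ultimately have "\<not> Pi\<^sub>E {..<d} A \<subseteq> N"
    by (metis emeasure_mono le_zero_eq)
  then obtain y where y: "y \<in> Pi\<^sub>E {..<d} A" "y \<notin> N" by blast
  have "y \<in> space (torus d)" using y(1) PiE_mono[of "{..<d}" A "\<lambda>_. {0..1}"] A01 unfolding space_torus by blast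
  moreover have "\<bar>y i - x0 i\<bar> \<le> \<delta>" if "i < d" for i
  proof -
    have "y i \<in> A i" using y(1) that by (auto simp: PiE_iff)
    then show ?thesis by (auto simp: A_def)
  qed
  ultimately show ?thesis using y(2) N(1) by blast
qed

text \<open>The enumeration \<open>\<sigma>\<close> orders the frequencies by decreasing weight, so
  that unordered sums become series over the natural numbers.\<close>

locale weighted_torus =
  fixes d :: nat and \<omega> :: "(nat \<Rightarrow> int) \<Rightarrow> real" and \<sigma> :: "nat \<Rightarrow> nat \<Rightarrow> int"
  assumes bij: "bij_betw \<sigma> UNIV (freqs d)"
    and \<omega>_pos: "0 < \<omega> (\<sigma> i)"
    and decreasing: "antimono (\<lambda>i. 1 / (\<omega> (\<sigma> i))\<^sup>2)"
    and summable_weights: "summable (\<lambda>i. 1 / (\<omega> (\<sigma> i))\<^sup>2)"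
begin

definition w :: "nat \<Rightarrow> real" where "w i = 1 / (\<omega> (\<sigma> i))\<^sup>2"

definition e :: "nat \<Rightarrow> (nat \<Rightarrow> real) \<Rightarrow> complex" where "e i = char d (\<sigma> i)"

definition coef :: "((nat \<Rightarrow> real) \<Rightarrow> complex) \<Rightarrow> nat \<Rightarrow> complex" where
  "coef f i = fhat d f (\<sigma> i)"

definition trig :: "nat \<Rightarrow> (nat \<Rightarrow> complex) \<Rightarrow> (nat \<Rightarrow> real) \<Rightarrow> complex" where
  "trig n a x = (\<Sum>i<n. a i * e i x)"

abbreviation unit_ball :: "((nat \<Rightarrow> real) \<Rightarrow> complex) set" where
  "unit_ball \<equiv> {f \<in> Hspace d \<omega>. Hnorm d \<omega> f \<le> 1}"

section \<open>Fourier series of functions in the weighted space\<close>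

lemma w_pos: "0 < w i" and w_summable: "summable w" and w_antimono: "antimono w"
  using \<omega>_pos[of i] summable_weights decreasing by (simp_all add: w_def[abs_def])

lemma w_nonneg: "0 \<le> w i"
  using w_pos[of i] by simp

lemma w_shift_summable: "summable (\<lambda>i. w (i + m))"
  using w_summable by (simp add: summable_iff_shift)

lemma norm_e [simp]: "cmod (e i x) = 1"
  by (simp add: e_def)

sublocale mean_orthonormal e "space (torus d)"
  unfolding e_def[abs_def] by (rule mean_orthonormal_char[OF bij])

lemma Hspace_bessel:
  assumes "f \<in> Hspace d \<omega>"
  shows "(\<lambda>i. (cmod (coef f i))\<^sup>2 / w i) sums (Hnorm d \<omega> f)\<^sup>2"
proof -
  let ?g = "\<lambda>k. (cmod (fhat d f k))\<^sup>2 * (\<omega> k)\<^sup>2"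
  have g: "?g (\<sigma> i) = (cmod (coef f i))\<^sup>2 / w i" for i
    by (simp add: coef_def w_def)
  have "(?g has_sum infsum ?g (freqs d)) (freqs d)"
    using assms by (simp add: Hspace_def)
  then have "((\<lambda>i. ?g (\<sigma> i)) has_sum infsum ?g (freqs d)) UNIV"
    using has_sum_reindex_bij_betw[OF bij, of ?g] by blast
  then have "(\<lambda>i. ?g (\<sigma> i)) sums infsum ?g (freqs d)" by (rule has_sum_imp_sums)
  moreover have "infsum ?g (freqs d) \<ge> 0" by (rule infsum_nonneg) simp
  ultimately show ?thesis unfolding g by (simp add: Hnorm_def)
qed

text \<open>By the inequality of arithmetic and geometric means, twice the modulus of a coefficient
  is at most the sum of its term in the norm and its weight, and both are summable.\<close>

lemma coef_summable:
  assumes "f \<in> Hspace d \<omega>"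
  shows "summable (\<lambda>i. cmod (coef f i))"
proof (rule summable_comparison_test')
  show "summable (\<lambda>i. (cmod (coef f i))\<^sup>2 / w i + w i)"
    by (intro summable_add w_summable sums_summable[OF Hspace_bessel[OF assms]])
  fix i
  have "0 \<le> (cmod (coef f i) / sqrt (w i) - sqrt (w i))\<^sup>2" by simp
  also have "\<dots> = (cmod (coef f i))\<^sup>2 / w i + w i - 2 * cmod (coef f i)"
    using w_pos[of i] by (simp add: power2_diff power_divide less_imp_le)
  finally show "norm (cmod (coef f i)) \<le> (cmod (coef f i))\<^sup>2 / w i + w i"
    using norm_ge_zero[of "coef f i"] unfolding real_norm_def abs_norm_cancel by linarith
qed

text \<open>Absolute summability identifies the unordered Fourier sum with the series along
  \<open>\<sigma>\<close>.\<close>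

lemma Hspace_sums:
  assumes "f \<in> Hspace d \<omega>"
  shows "(\<lambda>i. coef f i * e i x) sums f x"
proof -
  let ?g = "\<lambda>k. fhat d f k * exp (2 * complex_of_real pi * \<i> * complex_of_real (dotk d k x))"
  have g: "?g (\<sigma> i) = coef f i * e i x" for i
    by (simp add: coef_def e_def char_def)
  have N: "summable (\<lambda>i. cmod (coef f i * e i x))"
    using coef_summable[OF assms] by (simp add: norm_mult)
  have s: "(\<lambda>i. coef f i * e i x) sums (\<Sum>i. coef f i * e i x)"
    by (rule summable_sums[OF summable_norm_cancel[OF N]])
  from norm_summable_imp_has_sum[OF N s] have "(?g has_sum (\<Sum>i. coef f i * e i x)) (freqs d)"
    using has_sum_reindex_bij_betw[OF bij, of ?g] unfolding g by blast
  then have "f x = (\<Sum>i. coef f i * e i x)"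
    using assms unfolding Hspace_def by (auto simp: infsumI)
  then show ?thesis using s by simp
qed

lemma e_measurable [measurable]: "e i \<in> borel_measurable (torus d)"
  unfolding e_def by measurable

lemma Hspace_measurable:
  assumes "f \<in> Hspace d \<omega>"
  shows "f \<in> borel_measurable (torus d)"
proof -
  have "f = (\<lambda>x. \<Sum>i. coef f i * e i x)"
    using sums_unique[OF Hspace_sums[OF assms]] by auto
  moreover have "(\<lambda>x. \<Sum>i. coef f i * e i x) \<in> borel_measurable (torus d)" by measurable
  ultimately show ?thesis by simp
qed

lemma Hspace_bounded:
  assumes "f \<in> Hspace d \<omega>"
  shows "cmod (f x) \<le> (\<Sum>i. cmod (coef f i))"
proof -
  have "cmod (\<Sum>i. coef f i * e i x) \<le> (\<Sum>i. cmod (coef f i * e i x))"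
    by (rule summable_norm) (simp add: norm_mult coef_summable[OF assms])
  then show ?thesis using sums_unique[OF Hspace_sums[OF assms, of x]] by (simp add: norm_mult)
qed

lemma Hspace_integrable:
  assumes "f \<in> Hspace d \<omega>"
  shows "integrable (torus d) (\<lambda>x. f x * cnj (e i x))"
proof -
  interpret prob_space "torus d" by (rule prob_space_torus)
  have [measurable]: "f \<in> borel_measurable (torus d)" by (rule Hspace_measurable[OF assms])
  have "cnj \<in> borel_measurable borel" by (intro borel_measurable_continuous_onI continuous_intros)
  then have [measurable]: "(\<lambda>x. cnj (e i x)) \<in> borel_measurable (torus d)"
    by (rule measurable_compose[OF e_measurable])
  show ?thesis
    by (rule integrable_const_bound[of _ "\<Sum>i. cmod (coef f i)"])
       (auto simp: norm_mult Hspace_bounded[OF assms])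
qed

lemma coef_eq: "coef f i = integral\<^sup>L (torus d) (\<lambda>x. f x * cnj (e i x))"
  by (simp add: coef_def fhat_char e_def)

lemma coef_in_Lall: "(\<lambda>f. coef f i) \<in> Lall d \<omega>"
proof -
  \<comment> \<open>Continuity of the functional: a single term of the norm series is bounded by the
    whole.\<close>
  have "cmod (coef f i) \<le> sqrt (w i) * Hnorm d \<omega> f" if "f \<in> Hspace d \<omega>" for f
  proof -
    note s = Hspace_bessel[OF that]
    have "(\<Sum>j\<in>{i}. (cmod (coef f j))\<^sup>2 / w j) \<le> (\<Sum>j. (cmod (coef f j))\<^sup>2 / w j)"
      using sums_summable[OF s] w_nonneg by (intro sum_le_suminf) auto
    then have "(cmod (coef f i))\<^sup>2 / w i \<le> (Hnorm d \<omega> f)\<^sup>2"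
      using sums_unique[OF s] by simp
    then have "(cmod (coef f i))\<^sup>2 \<le> (sqrt (w i) * Hnorm d \<omega> f)\<^sup>2"
      using w_pos[of i] by (simp add: power_mult_distrib field_simps)
    moreover have "0 \<le> sqrt (w i) * Hnorm d \<omega> f"
      using w_nonneg by (auto simp: Hnorm_def intro!: mult_nonneg_nonneg infsum_nonneg)
    ultimately show ?thesis by (rule power2_le_imp_le)
  qed
  moreover have "coef (\<lambda>x. f x + g x) i = coef f i + coef g i"
    if "f \<in> Hspace d \<omega>" "g \<in> Hspace d \<omega>" for f g
    unfolding coef_eq distrib_right by (intro Bochner_Integration.integral_add Hspace_integrable that)
  moreover have "coef (\<lambda>x. a * f x) i = a * coef f i" for a f
    unfolding coef_eq by (simp add: mult.assoc)
  ultimately show ?thesis unfolding Lall_def by blast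
qed

lemma coef_trig: "coef (trig n a) j = (if j < n then a j else 0)"
proof -
  have \<sigma>: "\<sigma> i \<in> freqs d" "\<sigma> i = \<sigma> j \<longleftrightarrow> i = j" for i j
    using bij by (auto simp: bij_betw_def inj_eq)
  have "integrable (torus d) (\<lambda>x. e i x * cnj (e j x))" for i
    unfolding e_def char_mult_cnj by (rule char_integrable)
  then have "coef (trig n a) j = (\<Sum>i<n. a i * integral\<^sup>L (torus d) (\<lambda>x. e i x * cnj (e j x)))"
    unfolding coef_eq trig_def sum_distrib_right mult.assoc
    by (subst Bochner_Integration.integral_sum) auto
  also have "\<dots> = (\<Sum>i<n. if i = j then a j else 0)"
    unfolding e_def by (intro sum.cong refl) (auto simp: integral_char_mult_cnj \<sigma>)
  finally show ?thesis by simp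
qed

text \<open>Only finitely many coefficients are nonzero, so all unordered sums reduce to finite
  ones. These polynomials are the test functions of the lower bound.\<close>

lemma trig_Hspace: "trig n a \<in> Hspace d \<omega>"
  and Hnorm_trig: "Hnorm d \<omega> (trig n a) = sqrt (\<Sum>i<n. (cmod (a i))\<^sup>2 / w i)"
proof -
  let ?g = "\<lambda>k. (cmod (fhat d (trig n a) k))\<^sup>2 * (\<omega> k)\<^sup>2"
  let ?h = "\<lambda>x k. fhat d (trig n a) k * exp (2 * complex_of_real pi * \<i> * complex_of_real (dotk d k x))"
  have fin: "(q has_sum (\<Sum>i<n. q i)) UNIV" if "\<And>i. i \<ge> n \<Longrightarrow> q i = 0" for q :: "nat \<Rightarrow> 'c :: {comm_monoid_add,topological_space}"
    using has_sum_cong_neutral[of "UNIV" "{..<n}" q q] has_sum_finite[of "{..<n}" q] that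
    by (simp add: not_less)
  have g: "?g (\<sigma> i) = (cmod (if i < n then a i else 0))\<^sup>2 / w i"
   and h: "?h x (\<sigma> i) = (if i < n then a i else 0) * e i x" for i x
    by (simp_all add: coef_trig[of n a i, unfolded coef_def] w_def e_def char_def)
  have "((\<lambda>i. ?g (\<sigma> i)) has_sum (\<Sum>i<n. ?g (\<sigma> i))) UNIV"
    unfolding g by (rule fin) simp
  then have G: "(?g has_sum (\<Sum>i<n. (cmod (a i))\<^sup>2 / w i)) (freqs d)"
    using has_sum_reindex_bij_betw[OF bij, of ?g] unfolding g by simp
  have "(?h x has_sum trig n a x) (freqs d)" for x
  proof -
    have "((\<lambda>i. ?h x (\<sigma> i)) has_sum (\<Sum>i<n. ?h x (\<sigma> i))) UNIV"
      unfolding h by (rule fin) simp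
    moreover have "(\<Sum>i<n. ?h x (\<sigma> i)) = trig n a x"
      unfolding h trig_def by (intro sum.cong) auto
    ultimately show ?thesis
      using has_sum_reindex_bij_betw[OF bij, of "?h x"] by simp
  qed
  then show "trig n a \<in> Hspace d \<omega>"
    using has_sum_imp_summable[OF G] infsumI[symmetric] unfolding Hspace_def by blast
  show "Hnorm d \<omega> (trig n a) = sqrt (\<Sum>i<n. (cmod (a i))\<^sup>2 / w i)"
    unfolding Hnorm_def using G by (simp add: infsumI)
qed

text \<open>Linearity is only given on the space, so every scaled character and partial sum is first
  recognised as one of its members.\<close>

lemma Lall_trig:
  assumes "L \<in> Lall d \<omega>"
  shows "L (trig n a) = (\<Sum>i<n. a i * L (e i))"
proof -
  have e: "e i = trig (Suc i) (\<lambda>j. if j = i then 1 else 0)" for i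
    by (auto simp: trig_def fun_eq_iff)
  have eH: "e i \<in> Hspace d \<omega>" for i by (subst e) (rule trig_Hspace)
  have ce: "(\<lambda>x. c * e i x) = trig (Suc i) (\<lambda>j. if j = i then c else 0)" for c i
    by (auto simp: trig_def fun_eq_iff)
  have ceH: "(\<lambda>x. c * e i x) \<in> Hspace d \<omega>" for c i by (subst ce) (rule trig_Hspace)
  have add: "L (\<lambda>x. f x + g x) = L f + L g" if "f \<in> Hspace d \<omega>" "g \<in> Hspace d \<omega>" for f g
    using assms that unfolding Lall_def by blast
  have scale: "L (\<lambda>x. c * f x) = c * L f" if "f \<in> Hspace d \<omega>" for c f
    using assms that unfolding Lall_def by blast
  show ?thesis
  proof (induction n)
    case 0
    \<comment> \<open>The zero function is written as a scalar multiple so that homogeneity yields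
      the value 0.\<close>
    have "trig 0 a = (\<lambda>x. 0 * e 0 x)" by (simp add: trig_def fun_eq_iff)
    then show ?case using scale[OF eH, of 0] by simp
  next
    case (Suc n)
    have "trig (Suc n) a = (\<lambda>x. trig n a x + a n * e n x)" by (simp add: trig_def fun_eq_iff)
    then show ?case using add[OF trig_Hspace ceH] scale[OF eH] Suc by simp
  qed
qed

section \<open>Upper bounds for approximation and sampling\<close>

lemma bessel_partial:
  assumes "f \<in> unit_ball"
  shows "(\<Sum>i<N. (cmod (coef f i))\<^sup>2 / w i) \<le> 1"
proof -
  have s: "(\<lambda>i. (cmod (coef f i))\<^sup>2 / w i) sums (Hnorm d \<omega> f)\<^sup>2"
    using assms by (intro Hspace_bessel) simp
  have "(\<Sum>i<N. (cmod (coef f i))\<^sup>2 / w i) \<le> (\<Sum>i. (cmod (coef f i))\<^sup>2 / w i)"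
    using sums_summable[OF s] w_nonneg by (intro sum_le_suminf) auto
  also have "\<dots> = (Hnorm d \<omega> f)\<^sup>2" using sums_unique[OF s] by simp
  also have "\<dots> \<le> 1" using assms by (auto simp: Hnorm_def abs_square_le_1[symmetric] intro!: power_le_one infsum_nonneg)
  finally show ?thesis .
qed

text \<open>The tail of \<open>f\<close> lies in the unit ball of the kernel with shifted weights,
  and the diagonal of that kernel is the constant \<open>\<Sum>i. w (i + m)\<close>.\<close>

lemma tail_bound:
  assumes "f \<in> unit_ball"
  shows "cmod (f x - (\<Sum>i<m. coef f i * e i x)) \<le> sqrt (\<Sum>i. w (i + m))"
proof -
  let ?h = "\<lambda>x. f x - (\<Sum>i<m. coef f i * e i x)"
  have "kernel_le (rank_one ?h) (series_kernel (\<lambda>i. w (i + m)) (\<lambda>i. e (i + m)))"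
  proof (rule rank_one_le_series_kernel[where a = "\<lambda>i. coef f (i + m)"])
    show "(\<lambda>i. coef f (i + m) * e (i + m) x) sums ?h x" for x
      using Hspace_sums[of f x] assms by (subst sums_iff_shift) auto
    fix N
    have "(\<Sum>i<N. (cmod (coef f (i + m)))\<^sup>2 / w (i + m)) = (\<Sum>i\<in>{m..<N + m}. (cmod (coef f i))\<^sup>2 / w i)"
      using sum.shift_bounds_nat_ivl[of "\<lambda>i. (cmod (coef f i))\<^sup>2 / w i" 0 m N]
      by (simp add: atLeast0LessThan)
    also have "\<dots> \<le> (\<Sum>i<N + m. (cmod (coef f i))\<^sup>2 / w i)"
      using w_nonneg by (intro sum_mono2) auto
    also have "\<dots> \<le> 1" by (rule bessel_partial[OF assms])
    finally show "(\<Sum>i<N. (cmod (coef f (i + m)))\<^sup>2 / w (i + m)) \<le> 1" .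
  qed (auto simp: w_pos w_summable)
  from kernel_le_diag[OF this, of x] have "(cmod (?h x))\<^sup>2 \<le> (\<Sum>i. w (i + m))"
    by (subst (asm) series_kernel_diag)
       (auto simp: w_summable w_nonneg rank_one_diag)
  then show ?thesis by (rule real_le_rsqrt)
qed

lemma approximation_upper:
  "err d \<omega> (Lall d \<omega>) m \<le> ereal (sqrt (\<Sum>i. w (i + m)))"
proof -
  \<comment> \<open>The truncated Fourier series, which uses the first \<open>m\<close> coefficients
    as information.\<close>
  let ?LP = "(\<lambda>i f. coef f i, \<lambda>y x. \<Sum>i<m. y i * e i x)"
  have "err d \<omega> (Lall d \<omega>) m \<le> (SUP f \<in> unit_ball. esssup (torus d) (\<lambda>x. ereal (cmod (f x -
             (snd ?LP) (\<lambda>i. if i < m then (fst ?LP) i f else 0) x))))"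
    unfolding err_def by (rule INF_lower) (simp add: coef_in_Lall)
  also have "\<dots> \<le> ereal (sqrt (\<Sum>i. w (i + m)))"
  proof (rule SUP_least)
    fix f assume f: "f \<in> unit_ball"
    have [measurable]: "f \<in> borel_measurable (torus d)" using f by (intro Hspace_measurable) simp
    have "(\<Sum>i<m. (if i < m then coef f i else 0) * e i x) = (\<Sum>i<m. coef f i * e i x)" for x
      by (intro sum.cong) auto
    moreover have "esssup (torus d) (\<lambda>x. ereal (cmod (f x - (\<Sum>i<m. coef f i * e i x))))
        \<le> ereal (sqrt (\<Sum>i. w (i + m)))"
      using tail_bound[OF f, of _ m] by (intro esssup_I) (auto intro!: AE_I2)
    ultimately show "esssup (torus d) (\<lambda>x. ereal (cmod (f x -
             (snd ?LP) (\<lambda>i. if i < m then (fst ?LP) i f else 0) x))) \<le> ereal (sqrt (\<Sum>i. w (i + m)))"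
      by simp
  qed
  finally show ?thesis .
qed

text \<open>By the parallelogram law \<open>(f - g) / 2\<close> again lies in the unit ball, and it
  vanishes at the nodes, so the residual controls it.\<close>

lemma ball_difference_bound:
  assumes f: "f \<in> unit_ball" and g: "g \<in> unit_ball"
    and eq: "\<And>y. y \<in> set xs \<Longrightarrow> f y = g y"
  shows "(cmod (f x - g x) / 2)\<^sup>2 \<le> Re (residual (series_kernel w e) xs x x)"
proof -
  let ?h = "\<lambda>x. (f x - g x) / 2"
  have "(cmod (?h x))\<^sup>2 \<le> Re (residual (series_kernel w e) xs x x)"
  proof (rule residual_diag_ge)
    show "psd (series_kernel w e)" by (intro psd_series_kernel) (auto simp: w_summable w_nonneg)
    show "kernel_le (rank_one ?h) (series_kernel w e)"
    proof (rule rank_one_le_series_kernel[where a = "\<lambda>i. (coef f i - coef g i) / 2"])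
      show "(\<lambda>i. (coef f i - coef g i) / 2 * e i x) sums ?h x" for x
        using sums_divide[OF sums_diff[OF Hspace_sums[of f x] Hspace_sums[of g x]], of 2] f g
        by (simp add: left_diff_distrib)
      fix N
      have "(\<Sum>i<N. (cmod ((coef f i - coef g i) / 2))\<^sup>2 / w i)
          \<le> (\<Sum>i<N. ((cmod (coef f i))\<^sup>2 / w i + (cmod (coef g i))\<^sup>2 / w i) / 2)"
      proof (rule sum_mono)
        fix i
        have "(cmod (u - v))\<^sup>2 \<le> 2 * ((cmod u)\<^sup>2 + (cmod v)\<^sup>2)" for u v
        proof -
          have "(cmod (u - v))\<^sup>2 + (cmod (u + v))\<^sup>2 = 2 * ((cmod u)\<^sup>2 + (cmod v)\<^sup>2)"
            unfolding cmod_power2 by (simp add: power2_eq_square algebra_simps)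
          then show ?thesis by (metis add_increasing2 order_refl zero_le_power2)
        qed
        from this[of "coef f i" "coef g i"]
        have "(cmod ((coef f i - coef g i) / 2))\<^sup>2 \<le> ((cmod (coef f i))\<^sup>2 + (cmod (coef g i))\<^sup>2) / 2"
          by (simp add: norm_divide power_divide)
        then show "(cmod ((coef f i - coef g i) / 2))\<^sup>2 / w i
            \<le> ((cmod (coef f i))\<^sup>2 / w i + (cmod (coef g i))\<^sup>2 / w i) / 2"
          using divide_right_mono[OF _ w_nonneg[of i]] by (fastforce simp: add_divide_distrib)
      qed
      also have "\<dots> \<le> 1"
        using bessel_partial[OF f, of N] bessel_partial[OF g, of N]
        by (simp add: sum_divide_distrib[symmetric] sum.distrib)
      finally show "(\<Sum>i<N. (cmod ((coef f i - coef g i) / 2))\<^sup>2 / w i) \<le> 1" .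
    qed (auto simp: w_pos w_summable)
  qed (use eq in simp)
  then show ?thesis by (simp add: norm_divide)
qed

lemma sampling_upper:
  "err d \<omega> (Lstd d) (2 * m) \<le> ereal (12 * sqrt (\<Sum>i. w (i + m)))"
proof -
  define T where "T = (\<Sum>i. w (i + m))"
  obtain xs where xs: "set xs \<subseteq> space (torus d)" "length xs \<le> 2 * m"
    "\<And>x. x \<in> space (torus d) \<Longrightarrow> Re (residual (series_kernel w e) xs x x) \<le> 36 * T"
    using good_points[OF w_summable w_pos w_antimono, of m] unfolding T_def by blast
  \<comment> \<open>The list may be shorter than \<open>2 * m\<close>; it is padded with the origin,
    since extra samples do no harm.\<close>
  define pt where "pt i = (if i < length xs then xs ! i else (\<lambda>j\<in>{..<d}. 0))" for i
  have pt: "pt i \<in> space (torus d)" for i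
  proof (cases "i < length xs")
    case True
    then show ?thesis using xs(1) nth_mem[of i xs] by (auto simp: pt_def)
  qed (auto simp: pt_def space_torus)
  \<comment> \<open>The algorithm returns any function of the unit ball with the observed samples;
    for data coming from \<open>f\<close> such a function exists, namely \<open>f\<close>.\<close>
  define \<phi> where "\<phi> y = (SOME g. g \<in> unit_ball \<and> (\<forall>i<2 * m. g (pt i) = y i))" for y
  let ?LP = "(\<lambda>i f. f (pt i), \<phi>) :: (nat \<Rightarrow> ((nat \<Rightarrow> real) \<Rightarrow> complex) \<Rightarrow> complex) \<times> _"
  have "err d \<omega> (Lstd d) (2 * m) \<le> (SUP f \<in> unit_ball. esssup (torus d) (\<lambda>x. ereal (cmod (f x -
             (snd ?LP) (\<lambda>i. if i < 2 * m then (fst ?LP) i f else 0) x))))"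
    unfolding err_def by (rule INF_lower) (use pt in \<open>auto simp: Lstd_def\<close>)
  also have "\<dots> \<le> ereal (12 * sqrt T)"
  proof (rule SUP_least)
    fix f assume f: "f \<in> unit_ball"
    define g where "g = \<phi> (\<lambda>i. if i < 2 * m then f (pt i) else 0)"
    have "\<exists>g. g \<in> unit_ball \<and> (\<forall>i<2 * m. g (pt i) = (if i < 2 * m then f (pt i) else 0))"
      using f by auto
    from someI_ex[OF this] have g: "g \<in> unit_ball" and gf: "\<And>i. i < 2 * m \<Longrightarrow> g (pt i) = f (pt i)"
      unfolding g_def \<phi>_def by auto
    have eq: "f y = g y" if "y \<in> set xs" for y
      using that xs(2) gf by (metis in_set_conv_nth order_less_le_trans pt_def)
    have "cmod (f x - g x) \<le> 12 * sqrt T" if x: "x \<in> space (torus d)" for x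
    proof -
      \<comment> \<open>The constant 12 is twice the root of 36, the factor 2 coming from halving
        the difference.\<close>
      have "(cmod (f x - g x) / 2)\<^sup>2 \<le> 36 * T"
        using ball_difference_bound[OF f g eq] xs(3)[OF x] by (rule order_trans)
      then have "cmod (f x - g x) / 2 \<le> sqrt (36 * T)" by (rule real_le_rsqrt)
      also have "\<dots> = 6 * sqrt T" by (simp add: real_sqrt_mult)
      finally show ?thesis by simp
    qed
    moreover have [measurable]: "f \<in> borel_measurable (torus d)" "g \<in> borel_measurable (torus d)"
      using f g by (auto intro: Hspace_measurable)
    ultimately have "esssup (torus d) (\<lambda>x. ereal (cmod (f x - g x))) \<le> ereal (12 * sqrt T)"
      by (intro esssup_I) (auto intro!: AE_I2)
    then show "esssup (torus d) (\<lambda>x. ereal (cmod (f x -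
             (snd ?LP) (\<lambda>i. if i < 2 * m then (fst ?LP) i f else 0) x))) \<le> ereal (12 * sqrt T)"
      by (simp only: g_def fst_conv snd_conv)
  qed
  finally show ?thesis by (simp add: T_def)
qed

section \<open>The lower bound for arbitrary linear information\<close>

lemma trig_le_if_AE_le:
  assumes x0: "x0 \<in> space (torus d)" and S: "AE x in torus d. ereal (cmod (trig n a x)) \<le> S"
  shows "ereal (cmod (trig n a x0)) \<le> S"
proof -
  \<comment> \<open>Points satisfying the almost everywhere bound exist in boxes shrinking to
    \<open>x0\<close>; continuity of the polynomial carries the bound to \<open>x0\<close>
    itself.\<close>
  have "\<exists>y\<in>space (torus d). ereal (cmod (trig n a y)) \<le> S \<and> (\<forall>i<d. \<bar>y i - x0 i\<bar> \<le> 1 / real (Suc k))" for k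
    by (rule torus_box_meets_AE[OF x0 _ S]) simp
  then obtain y where y: "\<And>k. ereal (cmod (trig n a (y k))) \<le> S"
    "\<And>k i. i < d \<Longrightarrow> \<bar>y k i - x0 i\<bar> \<le> 1 / real (Suc k)" by metis
  have "(\<lambda>k. y k i) \<longlonglongrightarrow> x0 i" if "i < d" for i
  proof (rule LIM_zero_cancel, rule Lim_null_comparison)
    show "\<forall>\<^sub>F k in sequentially. norm (y k i - x0 i) \<le> 1 / real (Suc k)"
      using y(2)[OF that] by (intro always_eventually allI) (simp only: real_norm_def)
    show "(\<lambda>k. 1 / real (Suc k)) \<longlonglongrightarrow> 0"
      using LIMSEQ_inverse_real_of_nat by (simp only: inverse_eq_divide)
  qed
  then have "(\<lambda>k. trig n a (y k)) \<longlonglongrightarrow> trig n a x0"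
    unfolding trig_def e_def char_def dotk_def by (intro tendsto_intros) auto
  then have "(\<lambda>k. ereal (cmod (trig n a (y k)))) \<longlonglongrightarrow> ereal (cmod (trig n a x0))"
    by (intro tendsto_intros)
  then show ?thesis by (rule LIMSEQ_le_const2) (use y(1) in blast)
qed

text \<open>Since \<open>w\<close> decreases, mass at least \<open>N\<close> with entries in
  \<open>[0,1]\<close> has the least weighted sum when it fills the last \<open>N\<close> places.
  The proof compares every weight with \<open>w m\<close>.\<close>

lemma weighted_trace_ge:
  assumes "\<And>i. i < N + m \<Longrightarrow> 0 \<le> p i" "\<And>i. i < N + m \<Longrightarrow> p i \<le> 1" "real N \<le> (\<Sum>i<N + m. p i)"
  shows "(\<Sum>i<N. w (i + m)) \<le> (\<Sum>i<N + m. w i * p i)"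
proof -
  have split: "(\<Sum>i<N + m. f i) = (\<Sum>i<m. f i) + (\<Sum>i<N. f (i + m))" for f :: "nat \<Rightarrow> real"
    by (induction N) auto
  have "w m * (\<Sum>i<m. p i) \<le> (\<Sum>i<m. w i * p i)"
    unfolding sum_distrib_left using assms(1) antimonoD[OF w_antimono]
    by (intro sum_mono mult_right_mono) auto
  moreover have "(\<Sum>i<N. w (i + m) * (1 - p (i + m))) \<le> w m * (\<Sum>i<N. 1 - p (i + m))"
    unfolding sum_distrib_left using assms(2) antimonoD[OF w_antimono]
    by (intro sum_mono mult_right_mono) auto
  moreover have "0 \<le> w m * ((\<Sum>i<N + m. p i) - N)"
    using assms(3) w_nonneg by simp
  moreover have "(\<Sum>i<N. 1 - p (i + m)) = N - (\<Sum>i<N. p (i + m))"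
    by (simp add: sum_subtractf)
  ultimately show ?thesis
    unfolding split by (simp add: algebra_simps sum_subtractf)
qed

text \<open>The extremal function: the representer of point evaluation at a suitable \<open>x0\<close>, projected
  onto the trigonometric polynomials annihilated by the given functionals.\<close>

lemma extremal_function:
  assumes L: "\<And>i. i < m \<Longrightarrow> L i \<in> Lall d \<omega>" and "N > 0"
  obtains a x0 where "x0 \<in> space (torus d)" "Hnorm d \<omega> (trig (N + m) a) = 1"
    "\<And>j. j < m \<Longrightarrow> L j (trig (N + m) a) = 0"
    "sqrt (\<Sum>i<N. w (i + m)) \<le> cmod (trig (N + m) a x0)"
proof -
  define n where "n = N + m"
  define s where "s i = complex_of_real (sqrt (w i))" for i
  \<comment> \<open>The functions \<open>s i * e i\<close> are orthonormal in the weighted space, so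
    the functionals are represented by their values on these.\<close>
  obtain p where p: "proj_matrix n p" "real n - real m \<le> Re (\<Sum>i<n. p i i)"
    "\<And>j l. j < m \<Longrightarrow> (\<Sum>i<n. (L j (e i) * s i) * p i l) = 0"
    using proj_matrix_annihilating[of n m "\<lambda>j i. L j (e i) * s i"] by blast
  \<comment> \<open>Averaging over the torus gives a point where the projected representer has
    squared norm at least the weighted trace of \<open>p\<close>.\<close>
  obtain x0 where x0: "x0 \<in> space (torus d)"
    "Re (\<Sum>i<n. s i * p i i * cnj (s i)) \<le> Re (\<Sum>i<n. \<Sum>j<n. (s i * p i j * cnj (s j)) * e i x0 * cnj (e j x0))"
    using mean[of "\<lambda>i j. s i * p i j * cnj (s j)" n] by blast
  \<comment> \<open>The coordinates of the projected representer of evaluation at \<open>x0\<close>;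
    \<open>g\<close> is its squared norm and also its value at \<open>x0\<close>.\<close>
  define b where "b = proj_vec n p (\<lambda>j. s j * e j x0)"
  define g where "g = (\<Sum>i<n. (cmod (b i))\<^sup>2)"
  have G: "(\<Sum>i<n. (s i * e i x0) * b i) = of_real g"
    using proj_vec_facts(4)[OF p(1), of "\<lambda>j. s j * e j x0"]
    unfolding g_def b_def of_real_sum complex_norm_square by simp
  have "(\<Sum>i<n. \<Sum>j<n. (s i * p i j * cnj (s j)) * e i x0 * cnj (e j x0)) = of_real g"
    unfolding G[symmetric] b_def proj_vec_def by (simp add: sum_distrib_left mult_ac)
  then have "Re (\<Sum>i<n. s i * p i i * cnj (s i)) \<le> g" using x0(2) by simp
  moreover have "s i * p i i * cnj (s i) = of_real (w i) * p i i" for i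
  proof -
    have "s i * cnj (s i) = of_real (w i)"
      using w_nonneg[of i] by (simp add: s_def of_real_mult[symmetric] del: of_real_mult)
    then show ?thesis by (simp add: mult_ac)
  qed
  ultimately have "(\<Sum>i<n. w i * Re (p i i)) \<le> g" by simp
  moreover have "(\<Sum>i<N. w (i + m)) \<le> (\<Sum>i<n. w i * Re (p i i))"
    unfolding n_def using proj_matrix_diag[OF p(1)] p(2)
    by (intro weighted_trace_ge) (auto simp: n_def)
  ultimately have g: "(\<Sum>i<N. w (i + m)) \<le> g" by linarith
  moreover have "(\<Sum>i<N. w (i + m)) > 0" using \<open>N > 0\<close> w_pos by (intro sum_pos) auto
  ultimately have gpos: "g > 0" by linarith
  \<comment> \<open>Normalisation by \<open>sqrt g\<close> gives norm 1 and the value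
    \<open>g / sqrt g = sqrt g\<close> at \<open>x0\<close>.\<close>
  define a where "a i = s i * b i / of_real (sqrt g)" for i
  have "L j (trig n a) = 0" if "j < m" for j
  proof -
    have "L j (trig n a) = (\<Sum>i<n. a i * L j (e i))" by (rule Lall_trig[OF L[OF that]])
    also have "\<dots> = (\<Sum>i<n. (L j (e i) * s i) * b i) / of_real (sqrt g)"
      by (simp add: a_def sum_divide_distrib mult_ac)
    also have "(\<Sum>i<n. (L j (e i) * s i) * b i) =
        (\<Sum>l<n. (\<Sum>i<n. (L j (e i) * s i) * p i l) * cnj (s l * e l x0))"
      unfolding b_def proj_vec_def sum_distrib_left sum_distrib_right
      by (subst sum.swap) (simp add: mult.assoc)
    also have "\<dots> = 0" using p(3)[OF that] by simp
    finally show ?thesis by simp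
  qed
  moreover have "Hnorm d \<omega> (trig n a) = 1"
  proof -
    have "(cmod (a i))\<^sup>2 / w i = (cmod (b i))\<^sup>2 / g" for i
      using w_pos[of i] gpos
      by (simp add: a_def s_def norm_mult norm_divide power_mult_distrib power_divide less_imp_le)
    then show ?thesis using gpos
      by (simp add: Hnorm_trig sum_divide_distrib[symmetric] g_def[symmetric])
  qed
  moreover have "cmod (trig n a x0) = sqrt g"
  proof -
    have "trig n a x0 = (\<Sum>i<n. (s i * e i x0) * b i) / of_real (sqrt g)"
      by (simp add: trig_def a_def sum_divide_distrib mult_ac)
    also have "\<dots> = of_real (g / sqrt g)" unfolding G by simp
    also have "g / sqrt g = sqrt g" using gpos by (simp add: real_div_sqrt)
    finally show ?thesis using gpos by simp
  qed
  ultimately show ?thesis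
    using that[of x0 a] x0(1) g unfolding n_def by (simp add: real_sqrt_le_mono)
qed

text \<open>The extremal function and its negative give the same zero data, hence the same output,
  and no single output is closer to both than the modulus of the function.\<close>

lemma approximation_lower:
  "ereal (sqrt (\<Sum>i. w (i + m))) \<le> err d \<omega> (Lall d \<omega>) m"
  unfolding err_def
proof (rule INF_greatest)
  fix LP :: "(nat \<Rightarrow> ((nat \<Rightarrow> real) \<Rightarrow> complex) \<Rightarrow> complex)
      \<times> ((nat \<Rightarrow> complex) \<Rightarrow> (nat \<Rightarrow> real) \<Rightarrow> complex)"
  assume LP: "LP \<in> {(L, \<phi>). \<forall>i<m. L i \<in> Lall d \<omega>}"
  obtain L \<phi> where LP_eq: "LP = (L, \<phi>)" by (cases LP)
  have L: "L i \<in> Lall d \<omega>" if "i < m" for i using LP LP_eq that by auto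
  define S where "S = (SUP f \<in> unit_ball. esssup (torus d) (\<lambda>x. ereal (cmod (f x -
             (snd LP) (\<lambda>i. if i < m then (fst LP) i f else 0) x))))"
  \<comment> \<open>\<open>Suc N\<close> meets the positivity condition of the extremal function;
    the limit in \<open>N\<close> is taken at the end.\<close>
  have N: "ereal (sqrt (\<Sum>i<Suc N. w (i + m))) \<le> S" for N
  proof -
    obtain a x0 where a: "x0 \<in> space (torus d)" "Hnorm d \<omega> (trig (Suc N + m) a) = 1"
        "\<And>j. j < m \<Longrightarrow> L j (trig (Suc N + m) a) = 0"
        "sqrt (\<Sum>i<Suc N. w (i + m)) \<le> cmod (trig (Suc N + m) a x0)"
      using extremal_function[of m L "Suc N", OF L zero_less_Suc] by blast
    define f where "f = trig (Suc N + m) a"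
    define u where "u = \<phi> (\<lambda>_. 0)"
    have nf: "(\<lambda>x. - f x) = trig (Suc N + m) (\<lambda>i. - a i)"
      by (simp add: f_def trig_def fun_eq_iff sum_negf)
    have "L j (\<lambda>x. - f x) = 0" if "j < m" for j
    proof -
      have "L j (\<lambda>x. - f x) = - L j f"
        unfolding nf unfolding f_def by (simp only: Lall_trig[OF L[OF that]] sum_negf mult_minus_left)
      then show ?thesis using a(3)[OF that] by (simp add: f_def)
    qed
    then have data: "(\<lambda>i. if i < m then L i (\<lambda>x. - f x) else 0) = (\<lambda>_. 0)" by auto
    have dataf: "(\<lambda>i. if i < m then L i f else 0) = (\<lambda>_. 0)" using a(3) by (auto simp: f_def)
    have fb: "f \<in> unit_ball" using a(2) by (simp add: f_def trig_Hspace)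
    have nfb: "(\<lambda>x. - f x) \<in> unit_ball"
      using a(2) unfolding nf by (simp add: trig_Hspace Hnorm_trig)
    have "esssup (torus d) (\<lambda>x. ereal (cmod (f x - u x))) \<le> S"
      unfolding S_def by (rule SUP_upper2[OF fb]) (simp only: LP_eq fst_conv snd_conv dataf u_def order_refl)
    then have 1: "AE x in torus d. ereal (cmod (f x - u x)) \<le> S"
      using esssup_AE[where M = "torus d" and f = "\<lambda>x. ereal (cmod (f x - u x))"]
      by (auto elim!: eventually_mono)
    have "esssup (torus d) (\<lambda>x. ereal (cmod (- f x - u x))) \<le> S"
      unfolding S_def by (rule SUP_upper2[OF nfb]) (simp only: LP_eq fst_conv snd_conv data u_def order_refl)
    then have 2: "AE x in torus d. ereal (cmod (- f x - u x)) \<le> S"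
      using esssup_AE[where M = "torus d" and f = "\<lambda>x. ereal (cmod (- f x - u x))"]
      by (auto elim!: eventually_mono)
    have "AE x in torus d. ereal (cmod (trig (Suc N + m) a x)) \<le> S"
      using 1 2
    proof eventually_elim
      case (elim x)
      \<comment> \<open>The two errors add up to at least \<open>2 * cmod (f x)\<close>, so one of
        them is at least \<open>cmod (f x)\<close>; both are bounded by \<open>S\<close> almost
        everywhere.\<close>
      have "2 * cmod (f x) = cmod ((f x - u x) - (- f x - u x))"
        by (simp add: norm_mult flip: mult_2)
      also have "\<dots> \<le> cmod (f x - u x) + cmod (- f x - u x)" by (rule norm_triangle_ineq4)
      finally have "cmod (f x) \<le> cmod (f x - u x) \<or> cmod (f x) \<le> cmod (- f x - u x)" by linarith
      then show ?case using elim by (auto simp: f_def intro: order_trans[rotated])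
    qed
    then have "ereal (cmod (trig (Suc N + m) a x0)) \<le> S" by (rule trig_le_if_AE_le[OF a(1)])
    then show ?thesis using a(4) by (meson ereal_less_eq(3) order_trans)
  qed
  have "(\<lambda>N. \<Sum>i<Suc N. w (i + m)) \<longlonglongrightarrow> (\<Sum>i. w (i + m))"
    using summable_LIMSEQ[OF w_shift_summable] by (rule LIMSEQ_Suc)
  then have "(\<lambda>N. ereal (sqrt (\<Sum>i<Suc N. w (i + m)))) \<longlonglongrightarrow> ereal (sqrt (\<Sum>i. w (i + m)))"
    by (intro tendsto_intros)
  then have "ereal (sqrt (\<Sum>i. w (i + m))) \<le> S" by (rule LIMSEQ_le_const2) (use N in blast)
  then show "ereal (sqrt (\<Sum>i. w (i + m))) \<le> (SUP f \<in> unit_ball. esssup (torus d) (\<lambda>x. ereal (cmod (f x -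
             (snd LP) (\<lambda>i. if i < m then (fst LP) i f else 0) x))))"
    by (simp add: S_def)
qed

end

theorem theorem2p2:
  shows "\<exists>c1 c2 :: nat. c1 > 0 \<and> c2 > 0 \<and>
    (\<forall>(d::nat) (\<omega>::(nat \<Rightarrow> int) \<Rightarrow> real) (m::nat).
       d \<ge> 1 \<longrightarrow> (\<forall>k\<in>freqs d. \<omega> k > 0) \<longrightarrow>
       (\<lambda>k. 1 / (\<omega> k)\<^sup>2) summable_on freqs d \<longrightarrow>
       sampling_num d \<omega> (c1 * m) \<le> ereal (real c2) * approx_num d \<omega> (m + 1) \<and>
       approx_num d \<omega> (m + 1) = ereal (sqrt (\<Sum>k. lam d \<omega> (k + m + 1))))"
proof (rule exI[of _ 2], rule exI[of _ 12], intro conjI allI impI)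
  fix d :: nat and \<omega> :: "(nat \<Rightarrow> int) \<Rightarrow> real" and m :: nat
  assume d: "d \<ge> 1" and pos: "\<forall>k\<in>freqs d. \<omega> k > 0" and sm: "(\<lambda>k. 1 / (\<omega> k)\<^sup>2) summable_on freqs d"
  have "0 < 1 / (\<omega> k)\<^sup>2" if "k \<in> freqs d" for k using bspec[OF pos that] by simp
  \<comment> \<open>For \<open>d \<ge> 1\<close> the frequencies are infinite, so the natural
    numbers can enumerate them.\<close>
  then obtain \<sigma> :: "nat \<Rightarrow> nat \<Rightarrow> int" where \<sigma>: "bij_betw \<sigma> UNIV (freqs d)" "antimono (\<lambda>i. 1 / (\<omega> (\<sigma> i))\<^sup>2)"
    using decreasing_enumeration[OF infinite_freqs[OF d] _ sm] by blast
  have \<sigma>f: "\<sigma> i \<in> freqs d" for i using \<sigma>(1) by (auto simp: bij_betw_def)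
  have "(\<lambda>i. 1 / (\<omega> (\<sigma> i))\<^sup>2) summable_on UNIV"
    using summable_on_reindex_bij_betw[OF \<sigma>(1), of "\<lambda>k. 1 / (\<omega> k)\<^sup>2"] sm by simp
  then have sm': "summable (\<lambda>i. 1 / (\<omega> (\<sigma> i))\<^sup>2)"
    by (subst (asm) summable_on_UNIV_nonneg_real_iff) auto
  interpret weighted_torus d \<omega> \<sigma>
    using \<sigma> sm' pos \<sigma>f by unfold_locales auto
  \<comment> \<open>The summand 1 compensates for \<open>w\<close> being indexed from 0.\<close>
  have "lam d \<omega> (k + m + 1) = w (k + m)" for k
    using lam_enumeration[OF \<sigma> _ sm', of "k + m"] w_pos by (simp add: w_def)
  then have T: "(\<Sum>k. lam d \<omega> (k + m + 1)) = (\<Sum>k. w (k + m))" by simp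
  show eq: "approx_num d \<omega> (m + 1) = ereal (sqrt (\<Sum>k. lam d \<omega> (k + m + 1)))"
    unfolding approx_num_def T using approximation_upper[of m] approximation_lower[of m] by simp
  show "sampling_num d \<omega> (2 * m) \<le> ereal (real 12) * approx_num d \<omega> (m + 1)"
    unfolding eq unfolding sampling_num_def T using sampling_upper[of m] by simp
qed auto

end
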